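(* Let $f(x)=|x-\xi|^{\alpha}g(x)$ be the model function on $\Omega=[-1,1]$ described in the context, let $f_n$ be its Chebyshev projection of degree $n$, and let $p_n^{*}$ be its best approximation in the maximum norm by polynomials of degree at most $n$. Define $$V_0=\left\{x\in\Omega:\ \lim_{n\to\infty}\frac{|f(x)-f_n(x)|}{\|f-p_n^{*}\|_{L^{\infty}(\Omega)}}=0\right\}.$$ Then $V_0=\Omega\setminus\{\xi\}$.
   Context: Let $\Omega=[-1,1]$. The model function is $f(x)=|x-\xi|^{\alpha}g(x)$, where $\xi\in\Omega$; $\alpha>0$ is not an even integer if $\xi\in(-1,1)$ and is not an integer if $\xi=\pm1$; and $g\in C^{\infty}(\Omega)$ with $g(\xi)\neq0$. With $T_k(x)=\cos(k\arccos x)$ and Chebyshev coefficients $a_k=\frac{2}{\pi}\int_{-1}^{1}\frac{f(x)T_k(x)}{\sqrt{1-x^2}}\,dx$, the Chebyshev projection of degree $n$ of $f$ is $f_n(x)=\frac{a_0}{2}+\sum_{k=1}^{n}a_kT_k(x)$. Let $\Pi_n$ be the space of polynomials of degree at most $n$. The best approximation $p_n^{*}\in\Pi_n$ is the unique polynomial with $\|f-p_n^{*}\|_{L^{\infty}(\Omega)}=\min_{h\in\Pi_n}\|f-h\|_{L^{\infty}(\Omega)}$. *)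

theory Defs
  imports "HOL-Analysis.Analysis" "HOL-Computational_Algebra.Polynomial"
begin

abbreviation Omega :: "real set" where
  "Omega \<equiv> {-1..1}"

(* Derivatives at the endpoints of S are one-sided; D k is the k-th derivative of g on S.
   Continuity of every D k follows from its differentiability. *)
definition smooth_within :: "(real \<Rightarrow> real) \<Rightarrow> real set \<Rightarrow> bool" where
  "smooth_within g S \<longleftrightarrow>
     (\<exists>D :: nat \<Rightarrow> real \<Rightarrow> real.
        (\<forall>x\<in>S. D 0 x = g x) \<and>
        (\<forall>k. \<forall>x\<in>S. (D k has_real_derivative D (Suc k) x) (at x within S)))"

definition admissible_exponent :: "real \<Rightarrow> real \<Rightarrow> bool" where
  "admissible_exponent \<xi> \<alpha> \<longleftrightarrow>
     \<alpha> > 0 \<and>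
     (\<xi> \<in> {-1<..<1} \<longrightarrow> \<not> (\<exists>m::int. even m \<and> \<alpha> = of_int m)) \<and>
     (\<xi> = -1 \<or> \<xi> = 1 \<longrightarrow> \<alpha> \<notin> \<int>)"

(* Only the values on Omega are used. Since 0 powr \<alpha> = 0, the value at \<xi> is 0. *)
definition model_function :: "real \<Rightarrow> real \<Rightarrow> (real \<Rightarrow> real) \<Rightarrow> real \<Rightarrow> real" where
  "model_function \<xi> \<alpha> g x = \<bar>x - \<xi>\<bar> powr \<alpha> * g x"

definition cheb_T :: "nat \<Rightarrow> real \<Rightarrow> real" where
  "cheb_T k x = cos (real k * arccos x)"

(* At x = -1 and x = 1 the integrand is 0 by the convention y / 0 = 0; this null set does
   not affect the integral. For continuous f the integrand is absolutely integrable, so the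
   Henstock-Kurzweil integral is the Lebesgue integral. *)
definition cheb_coeff :: "(real \<Rightarrow> real) \<Rightarrow> nat \<Rightarrow> real" where
  "cheb_coeff f k = 2 / pi * integral Omega (\<lambda>x. f x * cheb_T k x / sqrt (1 - x\<^sup>2))"

definition cheb_proj :: "(real \<Rightarrow> real) \<Rightarrow> nat \<Rightarrow> real \<Rightarrow> real" where
  "cheb_proj f n x = cheb_coeff f 0 / 2 + (\<Sum>k=1..n. cheb_coeff f k * cheb_T k x)"

(* Only applied to functions continuous on Omega, for which the supremum is attained and
   coincides with the essential supremum. *)
definition max_norm :: "(real \<Rightarrow> real) \<Rightarrow> real" where
  "max_norm h = (SUP x\<in>Omega. \<bar>h x\<bar>)"

definition is_best_approx :: "(real \<Rightarrow> real) \<Rightarrow> nat \<Rightarrow> real poly \<Rightarrow> bool" where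
  "is_best_approx f n p \<longleftrightarrow>
     degree p \<le> n \<and>
     (\<forall>q. degree q \<le> n \<longrightarrow> max_norm (\<lambda>x. f x - poly p x) \<le> max_norm (\<lambda>x. f x - poly q x))"

definition V0 :: "(real \<Rightarrow> real) \<Rightarrow> (nat \<Rightarrow> real poly) \<Rightarrow> real set" where
  "V0 f p = {x \<in> Omega.
     (\<lambda>n. \<bar>f x - cheb_proj f n x\<bar> / max_norm (\<lambda>y. f y - poly (p n) y)) \<longlonglongrightarrow> 0}"

end

(* Write x = cos t, xi = cos t0, and let beta be alpha for interior xi and 2 alpha at an endpoint.
   The Fourier coefficients of |sin (t/2)|^beta satisfy a two-term recurrence, so they are C k^(-beta-1)
   up to a factor tending to 1, with C nonzero. As |cos t - cos t0| = 2 |sin ((t - t0)/2)| |sin ((t + t0)/2)|,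
   f (cos t) is a product of such factors and of a function with rapidly decaying coefficients. Multiplication
   is convolution of coefficients, and this gives a_k = c k^(-beta-1) (cos (k t0) + o(1)) with c nonzero.
   Summation by parts turns this into n^beta (f(x) - f_n(x)) -> L(x), where L(xi) is nonzero and L vanishes
   elsewhere. The absolute tail sums bound the best approximation error by O(n^(-beta)); conversely de la Vallee
   Poussin means, being bounded and reproducing polynomials, bound the average error at xi over the degrees
   n, ..., 2n-1 by four times the best approximation error, which is therefore of exact order n^(-beta). *)
theory Submission
  imports Defs "HOL-Real_Asymp.Real_Asymp"
begin

subsection \<open>Absolutely convergent Fourier series\<close>

text \<open>Passing to the circle makes translations available: a singularity at t0 is a shifted
  copy of the one at 0, which has no counterpart for Chebyshev series. This is why coefficients
  become bilateral and complex. In a product each singular term is multiplied by the value of the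
  other factor at the singular point, so g enters only through g(\<xi>), and the mirror points t0
  and -t0 combine to a cosine. At an endpoint these points coincide, the two sine factors merge and
  the exponent doubles. The recurrence has ratio (k - a) / (k + 1 + a) with a = beta/2. It breaks
  off exactly when a is a natural number, which is what the conditions on \<alpha> exclude. L(\<xi>)
  is nonzero because cos (k t0)^2 has mean 1/2, or 1 at an endpoint; for x different from \<xi> the
  product of the two cosines has mean zero. A single projection gives no sharp lower bound for the
  best approximation: its operator norm grows like log n, which would lose a logarithm. The averages
  have uniformly bounded norm, but they are useful only because the errors at \<xi> do not cancel,
  and this needs the limit L(\<xi>) rather than a mere order of magnitude.\<close>

lemma summable_on_norm_comparison:
  fixes f :: "'i \<Rightarrow> 'b :: banach"
  assumes "M summable_on A" "\<And>x. x \<in> A \<Longrightarrow> norm (f x) \<le> M x"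
  shows "f summable_on A"
  using Infinite_Sum.abs_summable_summable[OF Infinite_Sum.abs_summable_on_comparison_test'[OF assms]] .

lemma infsum_diff_banach:
  fixes f g :: "'i \<Rightarrow> 'b :: banach"
  assumes "f summable_on A" "g summable_on A"
  shows "infsum (\<lambda>x. f x - g x) A = infsum f A - infsum g A"
proof -
  have "((\<lambda>x. - g x) has_sum - infsum g A) A"
    using has_sum_infsum[OF assms(2)] by (simp add: has_sum_uminus)
  from has_sum_add[OF has_sum_infsum[OF assms(1)] this] show ?thesis
    by (auto intro: infsumI)
qed

text \<open>Dominated convergence for unordered sums (Tannery's theorem): a finite set carries all
  but e/3 of the majorant, and on it limits are taken termwise. The filter stays general because the
  application is along the cofinite filter on the integers.\<close>

lemma tendsto_infsum_zero:
  fixes a :: "'i \<Rightarrow> 'n \<Rightarrow> 'b :: banach"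
  assumes lim: "\<And>j. j \<in> A \<Longrightarrow> (a j \<longlongrightarrow> 0) F"
    and bound: "\<And>j n. j \<in> A \<Longrightarrow> norm (a j n) \<le> M j"
    and M: "M summable_on A"
  shows "((\<lambda>n. infsum (\<lambda>j. a j n) A) \<longlongrightarrow> 0) F"
proof (rule tendstoI)
  fix e :: real assume e: "e > 0"
  obtain J where J: "finite J" "J \<subseteq> A" "dist (sum M J) (infsum M A) \<le> e / 3"
    using has_sum_finite_approximation[OF has_sum_infsum[OF M], of "e/3"] e by auto
  have MJ: "M summable_on (A - J)"
    by (rule summable_on_subset_banach[OF M]) auto
  have "infsum M A = infsum M (A - J) + sum M J"
    using infsum_Un_disjoint[OF MJ, of J] J by (simp add: Un_absorb2 Int_commute)
  hence tail: "infsum M (A - J) \<le> e / 3"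
    using J(3) by (simp add: dist_real_def)
  have abs: "(\<lambda>j. norm (a j n)) summable_on B" if "B \<subseteq> A" for B n
    by (rule Infinite_Sum.abs_summable_on_comparison_test'[OF summable_on_subset_banach[OF M that]])
       (use bound that in auto)
  have "((\<lambda>n. \<Sum>j\<in>J. a j n) \<longlongrightarrow> (\<Sum>j\<in>J. 0)) F"
    by (rule tendsto_sum) (use lim J in auto)
  hence "\<forall>\<^sub>F n in F. dist (\<Sum>j\<in>J. a j n) 0 < e / 3"
    using e by (intro tendstoD) auto
  thus "\<forall>\<^sub>F n in F. dist (infsum (\<lambda>j. a j n) A) 0 < e"
  proof eventually_elim
    case (elim n)
    have "infsum (\<lambda>j. a j n) A = infsum (\<lambda>j. a j n) (A - J) + (\<Sum>j\<in>J. a j n)"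
      using infsum_Un_disjoint[OF abs_summable_summable[OF abs[of "A - J" n]], of J] J
      by (simp add: Un_absorb2 Int_commute)
    moreover have "norm (infsum (\<lambda>j. a j n) (A - J)) \<le> infsum (\<lambda>j. norm (a j n)) (A - J)"
      by (rule norm_infsum_bound[OF abs]) auto
    moreover have "infsum (\<lambda>j. norm (a j n)) (A - J) \<le> infsum M (A - J)"
      by (rule infsum_mono[OF abs MJ]) (use bound in auto)
    ultimately show ?case
      using elim tail e norm_triangle_ineq[of "infsum (\<lambda>j. a j n) (A - J)" "\<Sum>j\<in>J. a j n"]
      by simp
  qed
qed

text \<open>Absolute summability is built in: it makes the order of summation irrelevant and allows
  products to be rearranged into convolutions.\<close>

definition fourier_rep :: "(real \<Rightarrow> complex) \<Rightarrow> (int \<Rightarrow> complex) \<Rightarrow> bool" where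
  "fourier_rep F u \<longleftrightarrow> (\<lambda>k. norm (u k)) summable_on UNIV \<and>
     (\<forall>t. ((\<lambda>k. u k * cis (of_int k * t)) has_sum F t) UNIV)"

definition conv :: "(int \<Rightarrow> complex) \<Rightarrow> (int \<Rightarrow> complex) \<Rightarrow> int \<Rightarrow> complex" where
  "conv u v k = (\<Sum>\<^sub>\<infinity>j. u j * v (k - j))"

lemma summable_on_prod_norm:
  fixes u v :: "int \<Rightarrow> complex"
  assumes "(\<lambda>k. norm (u k)) summable_on UNIV" "(\<lambda>k. norm (v k)) summable_on UNIV"
  shows "(\<lambda>(i,j). norm (u i * v j)) summable_on (UNIV \<times> UNIV)"
proof -
  have "(\<lambda>p. norm (case p of (i, j) \<Rightarrow> u i * v j)) summable_on (UNIV \<times> UNIV)"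
    unfolding Infinite_Sum.abs_summable_on_Sigma_iff
    using assms by (auto simp: norm_mult abs_mult infsum_nonneg infsum_cmult_right' intro!: summable_on_cmult_right summable_on_cmult_left)
  thus ?thesis
    by (simp add: case_prod_unfold)
qed

text \<open>The shear (k, j) -> (j, k - j) is a bijection of the integer lattice and carries the
  convolution double series to the product of two absolutely convergent series.\<close>

lemma conv_norm_summable:
  fixes u v :: "int \<Rightarrow> complex"
  assumes "(\<lambda>k. norm (u k)) summable_on UNIV" "(\<lambda>k. norm (v k)) summable_on UNIV"
  shows "(\<lambda>(k,j). norm (u j * v (k - j))) summable_on (UNIV \<times> UNIV)"
    and "(\<lambda>j. norm (u j * v (k - j))) summable_on UNIV"
proof -
  define \<phi> where "\<phi> = (\<lambda>(k,j). (j, k - j :: int))"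
  have bij: "bij_betw \<phi> (UNIV \<times> UNIV) (UNIV \<times> UNIV)"
    by (rule bij_betwI[of _ _ _ "\<lambda>(i,j). (i + j, i)"]) (auto simp: \<phi>_def)
  show S: "(\<lambda>(k,j). norm (u j * v (k - j))) summable_on (UNIV \<times> UNIV)"
    using summable_on_prod_norm[OF assms]
      summable_on_reindex_bij_betw[OF bij, of "\<lambda>(i,j). norm (u i * v j)"]
    by (simp add: \<phi>_def case_prod_unfold)
  show "(\<lambda>j. norm (u j * v (k - j))) summable_on UNIV"
    using summable_on_SigmaD1[OF S, of k] by simp
qed

lemma fourier_rep_mult:
  assumes F: "fourier_rep F u" and G: "fourier_rep G v"
  shows "fourier_rep (\<lambda>t. F t * G t) (conv u v)"
proof -
  have u: "(\<lambda>k. norm (u k)) summable_on UNIV" and v: "(\<lambda>k. norm (v k)) summable_on UNIV"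
    using F G by (auto simp: fourier_rep_def)
  define \<phi> where "\<phi> = (\<lambda>(k,j). (j, k - j :: int))"
  have bij: "bij_betw \<phi> (UNIV \<times> UNIV) (UNIV \<times> UNIV)"
    by (rule bij_betwI[of _ _ _ "\<lambda>(i,j). (i + j, i)"]) (auto simp: \<phi>_def)
  note S = conv_norm_summable(1)[OF u v] and Sk = conv_norm_summable(2)[OF u v]
  have "(\<lambda>k. \<Sum>\<^sub>\<infinity>j. norm (u j * v (k - j))) summable_on UNIV"
    using summable_on_Sigma_banach[OF S] by simp
  hence A: "(\<lambda>k. norm (conv u v k)) summable_on UNIV"
    by (rule Infinite_Sum.abs_summable_on_comparison_test') (auto simp: conv_def intro!: norm_infsum_bound Sk)
  have "((\<lambda>k. conv u v k * cis (of_int k * t)) has_sum F t * G t) UNIV" for t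
  proof -
    define U where "U = (\<lambda>k. u k * cis (of_int k * t))"
    define V where "V = (\<lambda>k. v k * cis (of_int k * t))"
    have U: "(U has_sum F t) UNIV" and V: "(V has_sum G t) UNIV"
      using F G by (auto simp: fourier_rep_def U_def V_def)
    have nU: "norm (U k) = norm (u k)" and nV: "norm (V k) = norm (v k)" for k
      by (auto simp: U_def V_def norm_mult)
    have SP: "(\<lambda>(i,j). U i * V j) summable_on (UNIV \<times> UNIV)"
      by (rule abs_summable_summable)
         (use summable_on_prod_norm[of U V] u v in \<open>simp add: nU nV case_prod_unfold\<close>)
    have "((\<lambda>(i,j). U i * V j) has_sum F t * G t) (UNIV \<times> UNIV)"
    proof (rule has_sum_SigmaI[OF _ _ SP])
      show "((\<lambda>j. case (i, j) of (i, j) \<Rightarrow> U i * V j) has_sum U i * G t) UNIV" for i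
        using has_sum_cmult_right[OF V] by simp
      show "((\<lambda>i. U i * G t) has_sum F t * G t) UNIV"
        by (rule has_sum_cmult_left[OF U])
    qed
    \<comment> \<open>The same double series is summed a second time: rows gave the product of the
      values, and after the shear the sums at fixed k give the convolution.\<close>
    hence "((\<lambda>(k,j). U j * V (k - j)) has_sum F t * G t) (UNIV \<times> UNIV)"
      using has_sum_reindex_bij_betw[OF bij, of "\<lambda>(i,j). U i * V j" "F t * G t"]
      by (simp add: \<phi>_def case_prod_unfold)
    moreover have "((\<lambda>j. case (k, j) of (k, j) \<Rightarrow> U j * V (k - j)) has_sum
        conv u v k * cis (of_int k * t)) UNIV" for k
    proof -
      have "U j * V (k - j) = u j * v (k - j) * cis (of_int k * t)" for j
        by (simp add: U_def V_def cis_mult algebra_simps)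
      moreover have "((\<lambda>j. u j * v (k - j)) has_sum conv u v k) UNIV"
        unfolding conv_def by (rule has_sum_infsum[OF Infinite_Sum.abs_summable_summable[OF Sk]])
      ultimately show ?thesis
        using has_sum_cmult_left[of "\<lambda>j. u j * v (k - j)"] by simp
    qed
    ultimately show ?thesis
      by (rule has_sum_Sigma'[where A = UNIV and B = "\<lambda>_. UNIV"])
  qed
  thus ?thesis
    using A by (simp add: fourier_rep_def)
qed

lemma fourier_rep_shift:
  assumes "fourier_rep F u"
  shows "fourier_rep (\<lambda>t. F (t - s)) (\<lambda>k. u k * cis (- (of_int k * s)))"
proof -
  have "(\<lambda>k. u k * cis (- (of_int k * s)) * cis (of_int k * t)) = (\<lambda>k. u k * cis (of_int k * (t - s)))" for t
    unfolding mult.assoc cis_mult by (simp add: algebra_simps)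
  thus ?thesis
    using assms unfolding fourier_rep_def by (simp add: norm_mult del: mult_eq_0_iff mult_cancel_left)
qed

lemma fourier_rep_cmult:
  assumes "fourier_rep F u"
  shows "fourier_rep (\<lambda>t. c * F t) (\<lambda>k. c * u k)"
  using assms by (auto simp: fourier_rep_def norm_mult mult.assoc
      intro!: summable_on_cmult_right has_sum_cmult_right)

section \<open>Power-law asymptotics of coefficients and their behaviour under convolution\<close>

definition wt :: "real \<Rightarrow> int \<Rightarrow> real" where
  "wt s k = (1 + \<bar>of_int k\<bar>) powr s"

text \<open>Encodes u(k) = (1 + |k|)^(-s) (P(k) + o(1)) as |k| grows. The relevant P oscillate like
  cos (k t0), so a vanishing difference takes the place of a limit or a quotient; P = 0 expresses
  faster decay.\<close>

definition profile :: "real \<Rightarrow> (int \<Rightarrow> complex) \<Rightarrow> (int \<Rightarrow> complex) \<Rightarrow> bool" where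
  "profile s u P \<longleftrightarrow> bounded (range P) \<and> ((\<lambda>k. of_real (wt s k) * u k - P k) \<longlongrightarrow> 0) cofinite"

lemma wt_pos: "wt s k > 0"
  by (simp add: wt_def add_pos_nonneg)

lemma profile_bound:
  assumes "profile s u P"
  obtains M where "\<And>k. wt s k * norm (u k) \<le> M" "M \<ge> 0"
proof -
  obtain B where B: "\<And>k. norm (P k) \<le> B"
    using assms unfolding profile_def bounded_iff by blast
  have "\<forall>\<^sub>F k in cofinite. dist (of_real (wt s k) * u k - P k) 0 < 1"
    using assms by (intro tendstoD) (auto simp: profile_def)
  hence fin: "finite {k. \<not> dist (of_real (wt s k) * u k - P k) 0 < 1}"
    by (simp add: eventually_cofinite)
  define S where "S = {k. \<not> dist (of_real (wt s k) * u k - P k) 0 < 1}"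
  define M where "M = B + 1 + (\<Sum>k\<in>S. wt s k * norm (u k))"
  have B0: "B \<ge> 0"
    using B[of 0] norm_ge_zero[of "P 0"] by linarith
  have nn: "wt s k * norm (u k) \<ge> 0" for k
    using wt_pos[of s k] by simp
  have "wt s k * norm (u k) \<le> M" for k
  proof (cases "k \<in> S")
    case True
    thus ?thesis
      using member_le_sum[of k S "\<lambda>k. wt s k * norm (u k)"] fin nn B0 by (simp add: M_def S_def)
  next
    case False
    hence "norm (of_real (wt s k) * u k - P k) \<le> 1"
      by (simp add: S_def)
    hence "norm (of_real (wt s k) * u k) \<le> B + 1"
      using B[of k] norm_triangle_sub[of "of_real (wt s k) * u k" "P k"] by linarith
    hence "wt s k * norm (u k) \<le> B + 1"
      using wt_pos[of s k] by (simp add: norm_mult)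
    thus ?thesis
      using sum_nonneg[of S "\<lambda>k. wt s k * norm (u k)"] nn by (simp add: M_def)
  qed
  moreover have "M \<ge> 0"
    using B0 nn by (simp add: M_def sum_nonneg)
  ultimately show ?thesis
    using that by blast
qed

lemma summable_on_int_iff:
  fixes f :: "int \<Rightarrow> real"
  assumes "\<And>k. f k \<ge> 0" "summable (\<lambda>n. f (int n))" "summable (\<lambda>n. f (- int n))"
  shows "f summable_on UNIV"
proof -
  have "(f \<circ> int) summable_on UNIV" "(f \<circ> (\<lambda>n. - int n)) summable_on UNIV"
    using assms by (auto simp: summable_on_UNIV_nonneg_real_iff o_def)
  hence "f summable_on range int" "f summable_on range (\<lambda>n. - int n)"
    by (subst summable_on_reindex; auto simp: inj_on_def)+
  hence "f summable_on (range int \<union> (range (\<lambda>n. - int n) - range int))"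
    by (intro summable_on_Un_disjoint) (auto intro: summable_on_subset_banach)
  moreover have "range int \<union> (range (\<lambda>n. - int n) - range int) = UNIV"
    by (auto simp: image_iff) (metis int_cases2)
  ultimately show ?thesis by simp
qed

lemma wt_summable:
  assumes "s > 1"
  shows "(\<lambda>k. 1 / wt s k) summable_on UNIV"
proof (rule summable_on_int_iff)
  have "summable (\<lambda>n. of_nat (Suc n) powr (-s))"
    using assms by (subst summable_Suc_iff) (simp add: summable_real_powr_iff)
  thus "summable (\<lambda>n. 1 / wt s (int n))" "summable (\<lambda>n. 1 / wt s (- int n))"
    by (simp_all add: wt_def powr_minus_divide)
qed (use wt_pos[of s] in \<open>auto intro: less_imp_le\<close>)

lemma profile_summable:
  assumes "profile s u P" "s > 1"
  shows "(\<lambda>k. norm (u k)) summable_on UNIV"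
proof -
  obtain M where M: "\<And>k. wt s k * norm (u k) \<le> M"
    using profile_bound[OF assms(1)] by blast
  have "(\<lambda>k. M * (1 / wt s k)) summable_on UNIV"
    by (intro summable_on_cmult_right wt_summable assms)
  thus ?thesis
    by (rule Infinite_Sum.abs_summable_on_comparison_test') (use M wt_pos[of s] in \<open>auto simp: field_simps\<close>)
qed

lemma filterlim_abs_int_cofinite: "filterlim (\<lambda>k::int. \<bar>real_of_int k\<bar>) at_top cofinite"
  unfolding filterlim_at_top
proof
  fix Z :: real
  have "{k. \<not> Z \<le> \<bar>real_of_int k\<bar>} \<subseteq> {-\<lceil>\<bar>Z\<bar>\<rceil>..\<lceil>\<bar>Z\<bar>\<rceil>}"
    by (auto simp: abs_if split: if_splits) linarith+
  thus "\<forall>\<^sub>F k in cofinite. Z \<le> \<bar>real_of_int k\<bar>"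
    unfolding eventually_cofinite by (rule finite_subset) auto
qed

lemma filterlim_shift_cofinite: "filterlim (\<lambda>k::int. k - j) cofinite cofinite"
  unfolding filterlim_iff eventually_cofinite
proof (intro allI impI)
  fix P :: "int \<Rightarrow> bool" assume "finite {x. \<not> P x}"
  hence "finite ((\<lambda>k. k - j) -` {x. \<not> P x})"
    by (rule finite_vimageI) (auto simp: inj_on_def)
  thus "finite {x. \<not> P (x - j)}"
    by (simp add: vimage_def)
qed

lemma wt_ratio_tendsto: "((\<lambda>k. wt s k / wt s (k - j)) \<longlongrightarrow> 1) cofinite"
proof -
  have lim: "((\<lambda>k. \<bar>real_of_int j\<bar> / (1 + \<bar>real_of_int k\<bar>)) \<longlongrightarrow> 0) cofinite"
    by (rule filterlim_compose[OF _ filterlim_abs_int_cofinite]) real_asymp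
  have lim': "((\<lambda>k. \<bar>real_of_int j\<bar> / (1 + \<bar>real_of_int (k - j)\<bar>)) \<longlongrightarrow> 0) cofinite"
    using filterlim_compose[OF lim filterlim_shift_cofinite[of j]] .
  have "((\<lambda>k. (1 + \<bar>real_of_int k\<bar>) / (1 + \<bar>real_of_int (k - j)\<bar>) - 1) \<longlongrightarrow> 0) cofinite"
  proof (rule tendsto_0_le[OF lim', of _ 1], rule always_eventually, rule allI)
    fix k
    have "(1 + \<bar>real_of_int k\<bar>) / (1 + \<bar>real_of_int (k - j)\<bar>) - 1
        = (\<bar>real_of_int k\<bar> - \<bar>real_of_int (k - j)\<bar>) / (1 + \<bar>real_of_int (k - j)\<bar>)"
      by (simp add: field_simps add_pos_nonneg)
    thus "norm ((1 + \<bar>real_of_int k\<bar>) / (1 + \<bar>real_of_int (k - j)\<bar>) - 1)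
        \<le> norm (\<bar>real_of_int j\<bar> / (1 + \<bar>real_of_int (k - j)\<bar>)) * 1"
      by (simp add: divide_right_mono)
  qed
  hence "((\<lambda>k. (1 + \<bar>real_of_int k\<bar>) / (1 + \<bar>real_of_int (k - j)\<bar>)) \<longlongrightarrow> 1) cofinite"
    using Lim_null by blast
  hence "((\<lambda>k. ((1 + \<bar>real_of_int k\<bar>) / (1 + \<bar>real_of_int (k - j)\<bar>)) powr s) \<longlongrightarrow> 1 powr s) cofinite"
    by (rule tendsto_powr) auto
  thus ?thesis
    by (simp add: wt_def powr_divide)
qed

text \<open>The weights at k and k - j are asymptotically equal, so a shift of the sequence merely
  shifts P; boundedness of P absorbs the deviation of the weight ratio from 1.\<close>

lemma profile_shift:
  assumes "profile s u P"
  shows "((\<lambda>k. of_real (wt s k) * u (k - j) - P (k - j)) \<longlongrightarrow> 0) cofinite"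
proof -
  define e where "e = (\<lambda>k. of_real (wt s k) * u k - P k)"
  have "(e \<longlongrightarrow> 0) cofinite" and bd: "bounded (range P)"
    using assms by (auto simp: profile_def e_def)
  hence e: "((\<lambda>k. e (k - j)) \<longlongrightarrow> 0) cofinite"
    using filterlim_compose[OF _ filterlim_shift_cofinite[of j]] by blast
  define r where "r = (\<lambda>k. complex_of_real (wt s k / wt s (k - j)))"
  have r: "(r \<longlongrightarrow> 1) cofinite"
    using tendsto_of_real[OF wt_ratio_tendsto[of s j], where 'a = complex] by (simp add: r_def)
  obtain B where B: "\<And>k. norm (P k) \<le> B"
    using bd unfolding bounded_iff by blast
  have "((\<lambda>k. (r k - 1) * P (k - j)) \<longlongrightarrow> 0) cofinite"
  proof (rule tendsto_0_le[where f = "\<lambda>k. r k - 1" and K = B])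
    show "((\<lambda>k. r k - 1) \<longlongrightarrow> 0) cofinite"
      using r by (simp add: LIM_zero)
  qed (auto simp: norm_mult intro!: always_eventually mult_left_mono B)
  from tendsto_add[OF tendsto_mult[OF r e] this]
  have "((\<lambda>k. r k * e (k - j) + (r k - 1) * P (k - j)) \<longlongrightarrow> 0) cofinite"
    by simp
  moreover have "r k * e (k - j) + (r k - 1) * P (k - j)
      = of_real (wt s k) * u (k - j) - P (k - j)" for k
    using wt_pos[of s "k - j"] by (simp add: r_def e_def field_simps)
  ultimately show ?thesis by simp
qed

text \<open>The weight is comparable to its shift by \<open>j\<close> on \<open>\<bar>j\<bar> \<le> \<bar>k - j\<bar>\<close>; cutting the
  convolution there leaves two dominated sums.\<close>
lemma conv_half:
  fixes D :: "int \<Rightarrow> int \<Rightarrow> bool"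
  assumes u: "profile s u P" and s: "s > 1" and v: "(\<lambda>k. norm (v k)) summable_on UNIV"
    and D1: "\<And>j k. D j k \<Longrightarrow> \<bar>j\<bar> \<le> \<bar>k - j\<bar>"
    and D2: "\<And>j k. \<bar>k\<bar> > 2 * \<bar>j\<bar> \<Longrightarrow> D j k"
  shows "((\<lambda>k. (\<Sum>\<^sub>\<infinity>j. (if D j k then of_real (wt s k) * u (k - j) * v j else 0))
            - (\<Sum>\<^sub>\<infinity>j. P (k - j) * v j)) \<longlongrightarrow> 0) cofinite"
proof -
  obtain M where M: "\<And>k. wt s k * norm (u k) \<le> M" "M \<ge> 0"
    using profile_bound[OF u] by blast
  obtain B where B: "\<And>k. norm (P k) \<le> B"
    using u unfolding profile_def bounded_iff by blast
  have "((\<lambda>k. (\<Sum>\<^sub>\<infinity>j. (if D j k then of_real (wt s k) * u (k - j) * v j else 0) - P (k - j) * v j))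
     \<longlongrightarrow> 0) cofinite"
  proof (rule tendsto_infsum_zero)
    show "((\<lambda>k. (if D j k then of_real (wt s k) * u (k - j) * v j else 0) - P (k - j) * v j) \<longlongrightarrow> 0) cofinite" for j
    proof (rule Lim_transform_eventually)
      \<comment> \<open>For fixed j the cutoff holds for all large |k| by \<open>D2\<close>, so the
        termwise limit does not see it.\<close>
      show "((\<lambda>k. (of_real (wt s k) * u (k - j) - P (k - j)) * v j) \<longlongrightarrow> 0) cofinite"
        using tendsto_mult_right[OF profile_shift[OF u, of j], of "v j"] by simp
      have "\<forall>\<^sub>F k in cofinite. \<bar>real_of_int k\<bar> > 2 * \<bar>real_of_int j\<bar>"
        using filterlim_abs_int_cofinite by (simp add: filterlim_at_top_dense)
      thus "\<forall>\<^sub>F k in cofinite. (of_real (wt s k) * u (k - j) - P (k - j)) * v j =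
          (if D j k then of_real (wt s k) * u (k - j) * v j else 0) - P (k - j) * v j"
      proof eventually_elim
        case (elim k)
        hence "\<bar>k\<bar> > 2 * \<bar>j\<bar>" by linarith
        thus ?case using D2 by (simp add: algebra_simps)
      qed
    qed
    show "norm ((if D j k then of_real (wt s k) * u (k - j) * v j else 0) - P (k - j) * v j)
        \<le> (2 powr s * M + B) * norm (v j)" for j k
    proof -
      have 1: "norm (if D j k then of_real (wt s k) * u (k - j) * v j else 0) \<le> 2 powr s * M * norm (v j)"
      proof (cases "D j k")
        case True
        \<comment> \<open>Inside the cutoff |k| is at most twice |k - j|, which is the origin of the
          factor \<open>2 powr s\<close> in the majorant.\<close>
        have "\<bar>k\<bar> \<le> 2 * \<bar>k - j\<bar>" using D1[OF True] by arith
        hence "real_of_int \<bar>k\<bar> \<le> real_of_int (2 * \<bar>k - j\<bar>)"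
          by (simp only: of_int_le_iff)
        hence "1 + \<bar>real_of_int k\<bar> \<le> 2 * (1 + \<bar>real_of_int (k - j)\<bar>)" by simp
        hence "wt s k \<le> (2 * (1 + \<bar>real_of_int (k - j)\<bar>)) powr s"
          unfolding wt_def using s by (intro powr_mono2) auto
        also have "\<dots> = 2 powr s * wt s (k - j)"
          unfolding wt_def by (rule powr_mult)
        finally have "wt s k * norm (u (k - j)) \<le> 2 powr s * wt s (k - j) * norm (u (k - j))"
          by (rule mult_right_mono) simp
        also have "\<dots> \<le> 2 powr s * M"
          using M(1)[of "k - j"] by (simp add: mult.assoc)
        finally have "wt s k * norm (u (k - j)) * norm (v j) \<le> 2 powr s * M * norm (v j)"
          by (rule mult_right_mono) simp
        thus ?thesis
          using True wt_pos[of s k] by (simp add: norm_mult)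
      qed (use M in auto)
      have 2: "norm (P (k - j) * v j) \<le> B * norm (v j)"
        by (simp add: norm_mult mult_right_mono B)
      show ?thesis
        using 1 2 norm_triangle_ineq4[of "if D j k then of_real (wt s k) * u (k - j) * v j else 0" "P (k - j) * v j"]
        by (simp add: algebra_simps)
    qed
    show "(\<lambda>j. (2 powr s * M + B) * norm (v j)) summable_on UNIV"
      by (intro summable_on_cmult_right v)
  qed
  moreover have "(\<Sum>\<^sub>\<infinity>j. (if D j k then of_real (wt s k) * u (k - j) * v j else 0) - P (k - j) * v j)
     = (\<Sum>\<^sub>\<infinity>j. (if D j k then of_real (wt s k) * u (k - j) * v j else 0))
            - (\<Sum>\<^sub>\<infinity>j. P (k - j) * v j)" for k
  proof (rule infsum_diff_banach)
    obtain U where U: "\<And>k. norm (u k) \<le> U"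
    proof
      fix k
      have "1 \<le> wt s k"
        using s by (auto simp: wt_def intro!: ge_one_powr_ge_zero)
      hence "norm (u k) \<le> wt s k * norm (u k)"
        by (simp add: mult_right_le_one_le mult_le_cancel_right1)
      with M(1)[of k] show "norm (u k) \<le> M" by linarith
    qed
    have "(\<lambda>j. wt s k * U * norm (v j)) summable_on UNIV"
      by (intro summable_on_cmult_right v)
    moreover have "norm (if D j k then of_real (wt s k) * u (k - j) * v j else 0) \<le> wt s k * U * norm (v j)" for j
      using U[of "k - j"] wt_pos[of s k] order_trans[OF norm_ge_zero U]
      by (auto simp: norm_mult intro!: mult_right_mono mult_left_mono)
    ultimately show "(\<lambda>j. if D j k then of_real (wt s k) * u (k - j) * v j else 0) summable_on UNIV"
      by (rule summable_on_norm_comparison)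
    have "(\<lambda>j. B * norm (v j)) summable_on UNIV"
      by (intro summable_on_cmult_right v)
    thus "(\<lambda>j. P (k - j) * v j) summable_on UNIV"
      by (rule summable_on_norm_comparison)
         (auto simp: norm_mult mult_right_mono B)
  qed
  ultimately show ?thesis by simp
qed

text \<open>If two indices add up to k, one of them has modulus at least |k|/2. Where the index of u
  is the large one, u is governed by P while v is summed freely, and conversely. Hence the product
  rule: each profile is convolved with the other full sequence.\<close>

lemma conv_profile:
  assumes u: "profile s u P" and v: "profile s v Q" and s: "s > 1"
  shows "profile s (conv u v) (\<lambda>k. (\<Sum>\<^sub>\<infinity>j. P (k - j) * v j) + (\<Sum>\<^sub>\<infinity>j. Q (k - j) * u j))"
proof -
  note su = profile_summable[OF u s] and sv = profile_summable[OF v s]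
  \<comment> \<open>\<open>I1\<close> collects the terms where the index of u dominates,
    \<open>I2\<close> those where the index of v does. One inequality is strict, so that terms with
    equal moduli are counted once.\<close>
  define I1 where "I1 = (\<lambda>k j. if \<bar>j\<bar> \<le> \<bar>k - j\<bar> then of_real (wt s k) * u (k - j) * v j else 0)"
  define I2 where "I2 = (\<lambda>k j. if \<bar>j\<bar> < \<bar>k - j\<bar> then of_real (wt s k) * v (k - j) * u j else 0)"
  define L where "L = (\<lambda>k. (\<Sum>\<^sub>\<infinity>j. P (k - j) * v j) + (\<Sum>\<^sub>\<infinity>j. Q (k - j) * u j))"
  have h1: "((\<lambda>k. infsum (I1 k) UNIV - (\<Sum>\<^sub>\<infinity>j. P (k - j) * v j)) \<longlongrightarrow> 0) cofinite"
    unfolding I1_def by (rule conv_half[OF u s sv]) auto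
  have h2: "((\<lambda>k. infsum (I2 k) UNIV - (\<Sum>\<^sub>\<infinity>j. Q (k - j) * u j)) \<longlongrightarrow> 0) cofinite"
    unfolding I2_def by (rule conv_half[OF v s su]) auto
  have eq: "of_real (wt s k) * conv u v k = infsum (I1 k) UNIV + infsum (I2 k) UNIV" for k
  proof -
    note sm = conv_norm_summable(2)[OF su sv, of k]
    have bij: "bij_betw (\<lambda>j. k - j) UNIV UNIV"
      by (rule bij_betwI[of _ _ _ "\<lambda>j. k - j"]) auto
    have sm': "(\<lambda>j. wt s k * norm (u j * v (k - j))) summable_on UNIV"
      by (intro summable_on_cmult_right sm)
    \<comment> \<open>\<open>I1\<close> reindexed by j -> k - j; in this form its range and that of
      \<open>I2\<close> are complementary for each k.\<close>
    define J where "J = (\<lambda>j. if \<bar>k - j\<bar> \<le> \<bar>j\<bar> then of_real (wt s k) * (u j * v (k - j)) else 0)"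
    have sJ: "J summable_on UNIV"
      by (rule summable_on_norm_comparison[OF sm'])
         (use wt_pos[of s k] in \<open>auto simp: J_def norm_mult\<close>)
    have sI2: "I2 k summable_on UNIV"
      by (rule summable_on_norm_comparison[OF sm'])
         (use wt_pos[of s k] in \<open>auto simp: I2_def norm_mult\<close>)
    have "I1 k j = J (k - j)" for j
    proof -
      have "k - (k - j) = j" by simp
      thus ?thesis unfolding I1_def J_def by (simp only: mult_ac)
    qed
    hence "I1 k = (\<lambda>j. J (k - j))" ..
    hence "infsum (I1 k) UNIV = infsum J UNIV"
      using infsum_reindex_bij_betw[OF bij, of J] by simp
    moreover have "infsum J UNIV + infsum (I2 k) UNIV = (\<Sum>\<^sub>\<infinity>j. J j + I2 k j)"
      by (rule infsum_add[symmetric, OF sJ sI2])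
    moreover have "J j + I2 k j = of_real (wt s k) * (u j * v (k - j))" for j
      by (auto simp: J_def I2_def)
    ultimately show ?thesis
      by (simp add: conv_def infsum_cmult_right')
  qed
  have "((\<lambda>k. of_real (wt s k) * conv u v k - L k) \<longlongrightarrow> 0) cofinite"
    unfolding eq L_def using tendsto_add[OF h1 h2] by (simp add: algebra_simps)
  moreover have "bounded (range L)"
  proof -
    obtain A where A: "\<And>k. norm (P k) \<le> A"
      using u unfolding profile_def bounded_iff by blast
    obtain B where B: "\<And>k. norm (Q k) \<le> B"
      using v unfolding profile_def bounded_iff by blast
    have bd: "norm (\<Sum>\<^sub>\<infinity>j. R (k - j) * w j) \<le> C * (\<Sum>\<^sub>\<infinity>j. norm (w j))"
      if "\<And>k. norm (R k) \<le> C" "(\<lambda>k. norm (w k)) summable_on UNIV" for R w :: "int \<Rightarrow> complex" and C k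
    proof -
      have sw: "(\<lambda>j. C * norm (w j)) summable_on UNIV"
        by (intro summable_on_cmult_right that)
      have le: "norm (R (k - j) * w j) \<le> C * norm (w j)" for j
        by (simp add: norm_mult mult_right_mono that)
      have sm: "(\<lambda>j. norm (R (k - j) * w j)) summable_on UNIV"
        by (rule Infinite_Sum.abs_summable_on_comparison_test'[OF sw]) (use le in auto)
      have "norm (\<Sum>\<^sub>\<infinity>j. R (k - j) * w j) \<le> (\<Sum>\<^sub>\<infinity>j. norm (R (k - j) * w j))"
        by (rule norm_infsum_bound[OF sm])
      also have "\<dots> \<le> (\<Sum>\<^sub>\<infinity>j. C * norm (w j))"
        by (rule infsum_mono[OF sm sw le])
      finally show ?thesis by (simp add: infsum_cmult_right')
    qed
    have "norm (L k) \<le> A * (\<Sum>\<^sub>\<infinity>j. norm (v j)) + B * (\<Sum>\<^sub>\<infinity>j. norm (u j))" for k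
      unfolding L_def by (rule norm_triangle_le[OF add_mono[OF bd[OF A sv] bd[OF B su]]])
    thus ?thesis
      unfolding bounded_iff by blast
  qed
  ultimately show ?thesis
    by (simp add: profile_def L_def)
qed

subsection \<open>Chebyshev polynomials and coefficients\<close>

text \<open>\<open>cheb_T\<close> is a bare function defined through \<open>arccos\<close>; a
  version of type \<open>real poly\<close> is needed to speak of degrees, since best approximation
  ranges over polynomials.\<close>

fun chebyshev_poly :: "nat \<Rightarrow> real poly" where
  "chebyshev_poly 0 = 1"
| "chebyshev_poly (Suc 0) = [:0, 1:]"
| "chebyshev_poly (Suc (Suc n)) = [:0, 2:] * chebyshev_poly (Suc n) - chebyshev_poly n"

lemma cos_mult_cos: "cos x * cos y = (cos (x + y) + cos (x - y)) / (2::real)"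
  by (simp add: cos_add cos_diff)

lemma poly_chebyshev_poly: "poly (chebyshev_poly n) (cos t) = cos (real n * t)"
proof (induction n rule: chebyshev_poly.induct)
  case (3 n)
  show ?case
    using cos_mult_cos[of t "real (Suc n) * t"] 3 cos_minus[of "real n * t"]
    by (simp add: algebra_simps)
qed auto

lemma degree_chebyshev_poly: "degree (chebyshev_poly n) \<le> n"
proof (induction n rule: chebyshev_poly.induct)
  case (3 n)
  have "degree ([:0, 2:] * chebyshev_poly (Suc n)) \<le> Suc (Suc n)"
    using degree_mult_le[of "[:0, 2:]" "chebyshev_poly (Suc n)"] 3 by simp
  thus ?case
    using 3 by (auto intro!: degree_diff_le)
qed auto

lemma cos_in_Omega: "cos t \<in> Omega"
  by simp

lemma cheb_T_eq_poly: "x \<in> Omega \<Longrightarrow> cheb_T k x = poly (chebyshev_poly k) x"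
  using poly_chebyshev_poly[of k "arccos x"] by (simp add: cheb_T_def cos_arccos)

lemma cheb_T_cos: "cheb_T k (cos t) = cos (real k * t)"
  by (simp add: cheb_T_eq_poly poly_chebyshev_poly)

lemma continuous_on_comp_cos:
  "continuous_on Omega f \<Longrightarrow> continuous_on A (\<lambda>t. f (cos t))"
  by (rule continuous_on_compose2[of Omega f]) (auto intro!: continuous_intros)

lemma cheb_coeff_altdef:
  assumes "continuous_on Omega f"
  shows "cheb_coeff f k = 2 / pi * integral {0..pi} (\<lambda>t. f (cos t) * cos (real k * t))"
proof -
  define F where "F = (\<lambda>t. f (cos t) * cos (real k * t))"
  have cF: "continuous_on {0..pi} F"
    unfolding F_def by (intro continuous_intros continuous_on_comp_cos assms)
  \<comment> \<open>\<open>arccos\<close> decreases from pi to 0, so of the two oriented integrals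
    one is over an empty interval and the other carries a minus sign. The points -1 and 1, where
    \<open>arccos\<close> is not differentiable, form the exceptional set.\<close>
  have "((\<lambda>x. inverse (- sqrt (1 - x\<^sup>2)) *\<^sub>R F (arccos x)) has_integral
      integral {arccos (-1)..arccos 1} F - integral {arccos 1..arccos (-1)} F) {-1..1}"
  proof (rule has_integral_substitution_general[where s = "{-1,1}" and c = 0 and d = pi])
    show "arccos ` {-1..1} \<subseteq> {0..pi}"
      by (auto simp: arccos_lbound arccos_ubound)
    show "continuous_on {-1..1} arccos"
      by (rule continuous_on_arccos')
    show "(arccos has_real_derivative inverse (- sqrt (1 - x\<^sup>2))) (at x within {-1..1})"
      if "x \<in> {-1..1} - {-1,1}" for x
      using that by (intro has_field_derivative_at_within[OF DERIV_arccos]) auto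
  qed (use cF in auto)
  moreover have "integral {pi..0} F = 0"
    using pi_gt_zero by (simp del: pi_gt_zero)
  ultimately have "((\<lambda>x. inverse (- sqrt (1 - x\<^sup>2)) *\<^sub>R F (arccos x)) has_integral - integral {0..pi} F) {-1..1}"
    by simp
  from has_integral_neg[OF this]
  have "((\<lambda>x. - (inverse (- sqrt (1 - x\<^sup>2)) *\<^sub>R F (arccos x))) has_integral integral {0..pi} F) {-1..1}"
    by simp
  hence "((\<lambda>x. f x * cheb_T k x / sqrt (1 - x\<^sup>2)) has_integral integral {0..pi} F) {-1..1}"
    by (rule has_integral_eq[rotated]) (simp add: F_def cheb_T_def cos_arccos divide_inverse)
  thus ?thesis
    by (simp add: cheb_coeff_def F_def integral_unique)
qed

lemma cheb_coeff_integrable: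
  assumes "continuous_on Omega f"
  shows "(\<lambda>t. f (cos t) * cos (real k * t)) integrable_on {0..pi}"
  by (intro integrable_continuous_real continuous_intros continuous_on_comp_cos assms)

lemma cheb_coeff_add:
  assumes "continuous_on Omega f" "continuous_on Omega g"
  shows "cheb_coeff (\<lambda>x. f x + g x) k = cheb_coeff f k + cheb_coeff g k"
  using assms
  by (simp add: cheb_coeff_altdef continuous_on_add distrib_right distrib_left integral_add
      cheb_coeff_integrable)

lemma cheb_coeff_cmult:
  assumes "continuous_on Omega f"
  shows "cheb_coeff (\<lambda>x. c * f x) k = c * cheb_coeff f k"
  using assms
  by (simp add: cheb_coeff_altdef continuous_on_mult_left mult.assoc)

lemma cheb_coeff_diff:
  assumes "continuous_on Omega f" "continuous_on Omega g"
  shows "cheb_coeff (\<lambda>x. f x - g x) k = cheb_coeff f k - cheb_coeff g k"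
  using cheb_coeff_add[OF assms(1) continuous_on_mult_left[OF assms(2), of "-1"], of k]
    cheb_coeff_cmult[OF assms(2), of "-1" k] by simp

lemma cheb_coeff_cong:
  assumes "\<And>x. x \<in> Omega \<Longrightarrow> f x = g x"
  shows "cheb_coeff f k = cheb_coeff g k"
  unfolding cheb_coeff_def using assms by (intro arg_cong2[of _ _ _ _ "(*)"] integral_cong) auto

lemma cheb_coeff_sum:
  assumes "\<And>i. i \<in> I \<Longrightarrow> continuous_on Omega (f i)"
  shows "cheb_coeff (\<lambda>x. \<Sum>i\<in>I. f i x) k = (\<Sum>i\<in>I. cheb_coeff (f i) k)"
  using assms
proof (induction I rule: infinite_finite_induct)
  case (insert i I)
  thus ?case
    by (simp add: cheb_coeff_add continuous_on_sum)
qed (simp_all add: cheb_coeff_def)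

lemma cheb_coeff_bound:
  assumes f: "continuous_on Omega f" and M: "\<And>x. x \<in> Omega \<Longrightarrow> \<bar>f x\<bar> \<le> M"
  shows "\<bar>cheb_coeff f k\<bar> \<le> 2 * M"
proof -
  have "\<bar>f (cos t) * cos (real k * t)\<bar> \<le> M" for t
    using mult_mono[OF M[OF cos_in_Omega[of t]] abs_cos_le_one[of "real k * t"]] M[OF cos_in_Omega[of t]]
    by (simp add: abs_mult)
  hence "norm (integral {0..pi} (\<lambda>t. f (cos t) * cos (real k * t))) \<le> M * (pi - 0)"
    by (intro integral_bound) (auto intro!: continuous_intros continuous_on_comp_cos f)
  thus ?thesis
    by (simp add: cheb_coeff_altdef[OF f] abs_mult field_simps)
qed

lemma integral_cos_multiple:
  "integral {0..pi} (\<lambda>t. cos (of_int m * t)) = (if m = 0 then pi else 0)"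
proof (cases "m = 0")
  case False
  have "((\<lambda>t. cos (of_int m * t)) has_integral (sin (of_int m * pi) / of_int m - sin (of_int m * 0) / of_int m)) {0..pi}"
    using False
    by (intro fundamental_theorem_of_calculus)
       (auto simp flip: has_real_derivative_iff_has_vector_derivative intro!: derivative_eq_intros)
  thus ?thesis
    using False sin_zero_iff_int2[of "of_int m * pi"] by (auto simp: integral_unique)
qed simp

text \<open>The value 2 at degree 0 occurs because both frequencies j + k and j - k vanish there; it
  is compensated by the halved first term of the projection.\<close>

lemma cheb_coeff_cheb_T:
  "cheb_coeff (cheb_T j) k = (if j = k then (if k = 0 then 2 else 1) else 0)"
proof -
  have "cheb_coeff (cheb_T j) k = cheb_coeff (poly (chebyshev_poly j)) k"
    by (rule cheb_coeff_cong) (rule cheb_T_eq_poly)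
  also have "\<dots> = 2 / pi * integral {0..pi} (\<lambda>t. cos (real j * t) * cos (real k * t))"
    by (subst cheb_coeff_altdef) (auto intro!: continuous_intros simp: poly_chebyshev_poly)
  also have "integral {0..pi} (\<lambda>t. cos (real j * t) * cos (real k * t)) =
      integral {0..pi} (\<lambda>t. cos (of_int (int j + int k) * t) / 2 + cos (of_int (int j - int k) * t) / 2)"
    by (simp add: cos_mult_cos algebra_simps add_divide_distrib)
  also have "\<dots> = integral {0..pi} (\<lambda>t. cos (of_int (int j + int k) * t)) / 2
      + integral {0..pi} (\<lambda>t. cos (of_int (int j - int k) * t)) / 2"
    by (subst integral_add) (auto intro!: integrable_continuous_real continuous_intros)
  finally show ?thesis
    unfolding integral_cos_multiple by auto
qed

lemma continuous_on_cheb_T: "continuous_on Omega (cheb_T k)"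
  by (subst continuous_on_cong[OF refl cheb_T_eq_poly]) (auto intro!: continuous_intros)

text \<open>Inverts the Chebyshev basis without linear algebra: multiplication by cos t sends
  frequency j to the mean of the frequencies j - 1 and j + 1.\<close>

lemma cos_power_cosine_sum: "\<exists>d. \<forall>t. cos t ^ n = (\<Sum>j\<le>n. d j * cos (real j * t))"
proof (induction n)
  case (Suc n)
  then obtain d where d: "\<And>t. cos t ^ n = (\<Sum>j\<le>n. d j * cos (real j * t))" by blast
  have step: "\<exists>e. \<forall>t. cos t * cos (real j * t) = (\<Sum>i\<le>Suc n. e i * cos (real i * t))" if "j \<le> n" for j
  proof (cases j)
    case 0
    hence eq: "cos t * cos (real j * t) = (\<Sum>i\<le>Suc n. of_bool (i = 1) * cos (real i * t))" for t
      by simp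
    show ?thesis by (rule exI[of _ "\<lambda>i. of_bool (i = 1)"], rule allI, rule eq)
  next
    case (Suc i)
    have eq: "cos t * cos (real j * t) = (\<Sum>l\<le>Suc n. (of_bool (l = i) / 2 + of_bool (l = Suc j) / 2) * cos (real l * t))" for t
    proof -
      have "(\<Sum>l\<le>Suc n. (of_bool (l = i) / 2 + of_bool (l = Suc j) / 2) * cos (real l * t))
        = (\<Sum>l\<le>Suc n. of_bool (l = i) * (cos (real l * t) / 2)) + (\<Sum>l\<le>Suc n. of_bool (l = Suc j) * (cos (real l * t) / 2))"
        by (simp add: sum.distrib[symmetric] algebra_simps del: sum.atMost_Suc)
      also have "\<dots> = cos (real i * t) / 2 + cos (real (Suc j) * t) / 2"
        using Suc that by (simp add: sum_divide_distrib[symmetric] of_bool_def if_distrib[of "\<lambda>x. x * _"] del: sum.atMost_Suc sum_of_bool_mult_eq cong: if_cong)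
      also have "\<dots> = cos t * cos (real j * t)"
        using cos_mult_cos[of "real j * t" t] Suc by (simp add: algebra_simps)
      finally show ?thesis ..
    qed
    show ?thesis by (rule exI[of _ "\<lambda>l. of_bool (l = i) / 2 + of_bool (l = Suc j) / 2"], rule allI, rule eq)
  qed
  define e where "e = (\<lambda>j. SOME e. \<forall>t. cos t * cos (real j * t) = (\<Sum>i\<le>Suc n. e i * cos (real i * t)))"
  have e: "cos t * cos (real j * t) = (\<Sum>i\<le>Suc n. e j i * cos (real i * t))" if "j \<le> n" for j t
    unfolding e_def by (rule someI_ex[OF step[OF that], THEN spec])
  have eq: "cos t ^ Suc n = (\<Sum>i\<le>Suc n. (\<Sum>j\<le>n. d j * e j i) * cos (real i * t))" for t
  proof -
    have "cos t ^ Suc n = (\<Sum>j\<le>n. d j * (cos t * cos (real j * t)))"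
      by (simp add: d sum_distrib_left mult_ac)
    also have "\<dots> = (\<Sum>j\<le>n. \<Sum>i\<le>Suc n. d j * e j i * cos (real i * t))"
      by (simp add: e sum_distrib_left mult.assoc del: sum.atMost_Suc)
    also have "\<dots> = (\<Sum>i\<le>Suc n. \<Sum>j\<le>n. d j * e j i * cos (real i * t))"
      by (rule sum.swap)
    finally show ?thesis
      by (simp add: sum_distrib_right del: sum.atMost_Suc)
  qed
  show ?case by (rule exI[of _ "\<lambda>i. \<Sum>j\<le>n. d j * e j i"], rule allI, rule eq)
next
  case 0
  have eq: "cos t ^ 0 = (\<Sum>j\<le>0. 1 * cos (real j * t))" for t
    by simp
  show ?case by (rule exI[of _ "\<lambda>_. 1"], rule allI, rule eq)
qed

lemma poly_cheb_T_sum: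
  assumes "degree p \<le> n"
  obtains d where "\<And>x. x \<in> Omega \<Longrightarrow> poly p x = (\<Sum>j\<le>n. d j * cheb_T j x)"
proof -
  define c where "c = (\<lambda>i. SOME d. \<forall>t. cos t ^ i = (\<Sum>j\<le>i. d j * cos (real j * t)))"
  have c: "cos t ^ i = (\<Sum>j\<le>i. c i j * cos (real j * t))" for i t
    unfolding c_def by (rule someI_ex[OF cos_power_cosine_sum, THEN spec])
  define d where "d = (\<lambda>j. \<Sum>i\<le>n. if j \<le> i then coeff p i * c i j else 0)"
  have "poly p x = (\<Sum>j\<le>n. d j * cheb_T j x)" if "x \<in> Omega" for x
  proof -
    have x: "x = cos (arccos x)"
      using that by (simp add: cos_arccos)
    have "poly p x = (\<Sum>i\<le>n. coeff p i * x ^ i)"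
      unfolding poly_altdef using assms by (intro sum.mono_neutral_left) (auto simp: coeff_eq_0)
    also have "\<dots> = (\<Sum>i\<le>n. \<Sum>j\<le>i. coeff p i * c i j * cheb_T j x)"
      by (subst x, subst c) (simp add: cheb_T_def sum_distrib_left mult.assoc)
    also have "\<dots> = (\<Sum>i\<le>n. \<Sum>j\<le>n. if j \<le> i then coeff p i * c i j * cheb_T j x else 0)"
      by (intro sum.cong refl sum.mono_neutral_cong_left) auto
    also have "\<dots> = (\<Sum>j\<le>n. \<Sum>i\<le>n. if j \<le> i then coeff p i * c i j * cheb_T j x else 0)"
      by (rule sum.swap)
    also have "\<dots> = (\<Sum>j\<le>n. d j * cheb_T j x)"
      unfolding d_def sum_distrib_right by (intro sum.cong refl) auto
    finally show ?thesis .
  qed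
  thus ?thesis using that by blast
qed

lemma cheb_coeff_cosine_sum:
  "cheb_coeff (\<lambda>x. \<Sum>j\<le>n. d j * cheb_T j x) k = (if k \<le> n then (if k = 0 then 2 * d 0 else d k) else 0)"
proof -
  have "cheb_coeff (\<lambda>x. \<Sum>j\<le>n. d j * cheb_T j x) k = (\<Sum>j\<le>n. d j * cheb_coeff (cheb_T j) k)"
    by (subst cheb_coeff_sum)
       (auto intro!: continuous_intros continuous_on_cheb_T simp: cheb_coeff_cmult continuous_on_cheb_T)
  also have "\<dots> = (\<Sum>j\<le>n. if j = k then (if k = 0 then 2 * d 0 else d k) else 0)"
    by (intro sum.cong refl) (auto simp: cheb_coeff_cheb_T)
  finally show ?thesis by simp
qed

lemma cheb_proj_poly:
  assumes "degree p \<le> m" "x \<in> Omega"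
  shows "cheb_proj (poly p) m x = poly p x"
proof -
  obtain d where d: "\<And>x. x \<in> Omega \<Longrightarrow> poly p x = (\<Sum>j\<le>m. d j * cheb_T j x)"
    using poly_cheb_T_sum[OF assms(1)] by blast
  have c: "cheb_coeff (poly p) k = (if k \<le> m then (if k = 0 then 2 * d 0 else d k) else 0)" for k
    unfolding cheb_coeff_cosine_sum[of d m k, symmetric] by (rule cheb_coeff_cong) (rule d)
  have "cheb_proj (poly p) m x = d 0 + (\<Sum>j=1..m. d j * cheb_T j x)"
    unfolding cheb_proj_def c by simp
  also have "\<dots> = (\<Sum>j=0..m. d j * cheb_T j x)"
    by (subst sum.atLeast_Suc_atMost) (auto simp: cheb_T_def)
  finally show ?thesis
    using d[OF assms(2)] by (simp add: atMost_atLeast0)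
qed

lemma cheb_proj_diff:
  assumes "continuous_on Omega f" "continuous_on Omega g"
  shows "cheb_proj (\<lambda>x. f x - g x) n x = cheb_proj f n x - cheb_proj g n x"
  unfolding cheb_proj_def cheb_coeff_diff[OF assms]
  by (simp add: left_diff_distrib sum_subtractf diff_divide_distrib)

lemma cheb_proj_is_poly:
  obtains q where "degree q \<le> n" "\<And>x. x \<in> Omega \<Longrightarrow> cheb_proj f n x = poly q x"
proof
  define q where "q = [:cheb_coeff f 0 / 2:] + (\<Sum>k=1..n. smult (cheb_coeff f k) (chebyshev_poly k))"
  show "degree q \<le> n"
    unfolding q_def
    by (intro degree_add_le degree_sum_le)
       (auto intro: order_trans[OF degree_smult_le] order_trans[OF degree_chebyshev_poly])
  show "cheb_proj f n x = poly q x" if "x \<in> Omega" for x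
    by (simp add: cheb_proj_def q_def poly_sum cheb_T_eq_poly[OF that])
qed

subsection \<open>De la Vallee Poussin means\<close>

text \<open>The left side is a sum of Dirichlet kernels, the right side the squared modulus of a
  geometric sum of exponentials, so this is N times the Fejer kernel. Nonnegativity is visible
  without dividing by sin (t/2). In the induction the cross terms of the enlarged square supply the
  next Dirichlet kernel.\<close>

lemma fejer_kernel:
  "(\<Sum>m<N. 1 + 2 * (\<Sum>k=1..m. cos (real k * t))) = (\<Sum>j<N. cos (real j * t))\<^sup>2 + (\<Sum>j<N. sin (real j * t))\<^sup>2"
proof (induction N)
  case (Suc N)
  define C where "C = (\<Sum>j<N. cos (real j * t))"
  define S where "S = (\<Sum>j<N. sin (real j * t))"
  have "C * cos (real N * t) + S * sin (real N * t) = (\<Sum>j<N. cos (real (N - j) * t))"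
    unfolding C_def S_def sum_distrib_right sum.distrib[symmetric]
  proof (rule sum.cong)
    fix j assume "j \<in> {..<N}"
    hence "real (N - j) * t = real N * t - real j * t"
      by (simp add: of_nat_diff algebra_simps)
    thus "cos (real j * t) * cos (real N * t) + sin (real j * t) * sin (real N * t) = cos (real (N - j) * t)"
      by (simp add: cos_diff mult.commute)
  qed simp
  also have "\<dots> = (\<Sum>k=1..N. cos (real k * t))"
    by (rule sum.reindex_bij_witness[of _ "\<lambda>k. N - k" "\<lambda>j. N - j"]) auto
  finally have "2 * (\<Sum>k=1..N. cos (real k * t)) = 2 * C * cos (real N * t) + 2 * S * sin (real N * t)"
    by simp
  moreover have "(C + cos (real N * t))\<^sup>2 + (S + sin (real N * t))\<^sup>2
      = C\<^sup>2 + S\<^sup>2 + (2 * C * cos (real N * t) + 2 * S * sin (real N * t)) + ((cos (real N * t))\<^sup>2 + (sin (real N * t))\<^sup>2)"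
    by (simp add: power2_eq_square algebra_simps)
  ultimately show ?case
    using Suc by (simp add: C_def S_def)
qed simp

text \<open>In the angle variable, the integral kernel of the sum of the first N projections, with
  respect to d\<phi> / pi on [0, pi].\<close>

definition cheb_kernel :: "nat \<Rightarrow> real \<Rightarrow> real \<Rightarrow> real" where
  "cheb_kernel N t \<phi> = (\<Sum>m<N. 1 + 2 * (\<Sum>k=1..m. cos (real k * t) * cos (real k * \<phi>)))"

text \<open>The product formula for cosines splits the kernel into Fejer kernels at t + \<phi> and t
  - \<phi>, both sums of squares.\<close>

lemma cheb_kernel_nonneg: "cheb_kernel N t \<phi> \<ge> 0"
proof -
  have eq: "cos (real k * t) * cos (real k * \<phi>) = (cos (real k * (t + \<phi>)) + cos (real k * (t - \<phi>))) / 2" for k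
    using cos_mult_cos[of "real k * t" "real k * \<phi>"] by (simp add: algebra_simps)
  have "2 * cheb_kernel N t \<phi> = (\<Sum>m<N. 1 + 2 * (\<Sum>k=1..m. cos (real k * (t + \<phi>))))
      + (\<Sum>m<N. 1 + 2 * (\<Sum>k=1..m. cos (real k * (t - \<phi>))))"
    unfolding cheb_kernel_def eq sum_divide_distrib[symmetric] sum.distrib sum_distrib_left[symmetric]
    by simp
  also have "\<dots> \<ge> 0"
    unfolding fejer_kernel by simp
  finally show ?thesis by simp
qed

lemma sum_cheb_proj_kernel:
  assumes f: "continuous_on Omega f"
  shows "((\<lambda>\<phi>. f (cos \<phi>) * cheb_kernel N t \<phi>) has_integral pi * (\<Sum>m<N. cheb_proj f m (cos t))) {0..pi}"
proof -
  have I: "((\<lambda>\<phi>. f (cos \<phi>) * cos (real k * \<phi>)) has_integral pi / 2 * cheb_coeff f k) {0..pi}" for k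
    using integrable_integral[OF cheb_coeff_integrable[OF f, of k]] by (simp add: cheb_coeff_altdef[OF f])
  have "((\<lambda>\<phi>. \<Sum>m<N. f (cos \<phi>) * cos (real 0 * \<phi>) + (\<Sum>k=1..m. 2 * cos (real k * t) * (f (cos \<phi>) * cos (real k * \<phi>))))
    has_integral (\<Sum>m<N. pi / 2 * cheb_coeff f 0 + (\<Sum>k=1..m. 2 * cos (real k * t) * (pi / 2 * cheb_coeff f k)))) {0..pi}"
    by (intro has_integral_sum has_integral_add has_integral_mult_right I) auto
  moreover have "(\<Sum>m<N. pi / 2 * cheb_coeff f 0 + (\<Sum>k=1..m. 2 * cos (real k * t) * (pi / 2 * cheb_coeff f k)))
    = pi * (\<Sum>m<N. cheb_proj f m (cos t))"
    unfolding cheb_proj_def cheb_T_cos sum_distrib_left distrib_left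
    by (intro sum.cong refl) (simp add: mult_ac sum_distrib_left)
  moreover have "(\<lambda>\<phi>. \<Sum>m<N. f (cos \<phi>) * cos (real 0 * \<phi>) + (\<Sum>k=1..m. 2 * cos (real k * t) * (f (cos \<phi>) * cos (real k * \<phi>))))
    = (\<lambda>\<phi>. f (cos \<phi>) * cheb_kernel N t \<phi>)"
    unfolding cheb_kernel_def sum_distrib_left distrib_left
    by (intro ext sum.cong refl) (simp add: mult_ac sum_distrib_left)
  ultimately show ?thesis by simp
qed

text \<open>A nonnegative kernel has norm equal to its total mass, and the mass is read off by
  applying the operator to the constant 1. This is the gain of averaging over a single projection,
  whose kernel changes sign.\<close>

lemma sum_cheb_proj_bound:
  assumes f: "continuous_on Omega f" and M: "\<And>x. x \<in> Omega \<Longrightarrow> \<bar>f x\<bar> \<le> M" and x: "x \<in> Omega"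
  shows "\<bar>\<Sum>m<N. cheb_proj f m x\<bar> \<le> real N * M"
proof -
  define t where "t = arccos x"
  have xt: "x = cos t"
    using x by (simp add: t_def cos_arccos)
  have "poly 1 = (\<lambda>x. 1 :: real)"
    by auto
  hence "cheb_proj (\<lambda>x. 1) m (cos t) = 1" for m
    using cheb_proj_poly[of 1 m "cos t"] by simp
  hence 1: "((\<lambda>\<phi>. cheb_kernel N t \<phi>) has_integral pi * real N) {0..pi}"
    using sum_cheb_proj_kernel[of "\<lambda>x. 1" N t] by simp
  have "norm (pi * (\<Sum>m<N. cheb_proj f m (cos t))) \<le> M * (pi * real N)"
  proof -
    have "\<bar>f (cos \<phi>)\<bar> * cheb_kernel N t \<phi> \<le> M * cheb_kernel N t \<phi>" for \<phi>
      by (rule mult_right_mono[OF M cheb_kernel_nonneg]) simp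
    hence "norm (integral {0..pi} (\<lambda>\<phi>. f (cos \<phi>) * cheb_kernel N t \<phi>)) \<le> integral {0..pi} (\<lambda>\<phi>. M * cheb_kernel N t \<phi>)"
      using sum_cheb_proj_kernel[OF f, of N t] has_integral_mult_right[OF 1, of M]
      by (intro integral_norm_bound_integral) (auto simp: abs_mult cheb_kernel_nonneg)
    thus ?thesis
      using integral_unique[OF sum_cheb_proj_kernel[OF f, of N t]] integral_unique[OF 1]
      by simp
  qed
  thus ?thesis
    by (simp add: xt abs_mult mult.left_commute[of M] mult.commute[of M])
qed

text \<open>Projections of degree n and above reproduce p, so f may be replaced by h = f - p. The
  window of degrees is a difference of two full sums, costing 2n and n, and the subtracted value of
  h costs another n; together 4n.\<close>

lemma sum_cheb_proj_error:
  assumes f: "continuous_on Omega f" and p: "degree p \<le> n"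
    and M: "\<And>x. x \<in> Omega \<Longrightarrow> \<bar>f x - poly p x\<bar> \<le> M" and x: "x \<in> Omega"
  shows "\<bar>\<Sum>m=n..<2*n. cheb_proj f m x - f x\<bar> \<le> 4 * real n * M"
proof -
  define h where "h = (\<lambda>x. f x - poly p x)"
  have h: "continuous_on Omega h"
    unfolding h_def by (intro continuous_intros f)
  have "cheb_proj f m x - f x = cheb_proj h m x - h x" if "m \<ge> n" for m
    using cheb_proj_diff[OF f, of "poly p" m x] cheb_proj_poly[of p m x] p that x
    by (simp add: h_def continuous_intros)
  hence "(\<Sum>m=n..<2*n. cheb_proj f m x - f x) = (\<Sum>m=n..<2*n. cheb_proj h m x) - real n * h x"
    by (simp add: sum_subtractf)
  also have "(\<Sum>m=n..<2*n. cheb_proj h m x) = (\<Sum>m<2*n. cheb_proj h m x) - (\<Sum>m<n. cheb_proj h m x)"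
    by (simp add: sum_diff_nat_ivl[of 0 n "2*n", symmetric] lessThan_atLeast0)
  finally have eq: "(\<Sum>m=n..<2*n. cheb_proj f m x - f x)
      = (\<Sum>m<2*n. cheb_proj h m x) - (\<Sum>m<n. cheb_proj h m x) - real n * h x" .
  have hM: "\<bar>h y\<bar> \<le> M" if "y \<in> Omega" for y
    using M[OF that] by (simp add: h_def)
  have "\<bar>real n * h x\<bar> \<le> real n * M"
    using mult_left_mono[OF hM[OF x], of "real n"] by (simp add: abs_mult)
  moreover have "\<bar>\<Sum>m<2*n. cheb_proj h m x\<bar> \<le> real (2*n) * M"
    by (rule sum_cheb_proj_bound[OF h hM x])
  moreover have "\<bar>\<Sum>m<n. cheb_proj h m x\<bar> \<le> real n * M"
    by (rule sum_cheb_proj_bound[OF h hM x])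
  moreover have "4 * real n * M = real (2*n) * M + real n * M + real n * M"
    by simp
  ultimately show ?thesis
    unfolding eq by linarith
qed

lemma poly_approx_on_Omega:
  assumes "continuous_on Omega f" "e > 0"
  obtains p where "\<And>x. x \<in> Omega \<Longrightarrow> \<bar>f x - poly p x\<bar> < e"
proof -
  obtain g where g: "real_polynomial_function g" "\<And>x. x \<in> Omega \<Longrightarrow> \<bar>f x - g x\<bar> < e"
    using Stone_Weierstrass_real_polynomial_function[of Omega f e] assms by auto
  obtain a n where "g = (\<lambda>x. \<Sum>i\<le>n. a i * x ^ i)"
    using real_polynomial_function_imp_sum[OF g(1)] by blast
  hence "g = poly (\<Sum>i\<le>n. monom (a i) i)"
    by (auto simp: poly_sum poly_monom)
  thus ?thesis
    using g(2) that by metis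
qed

section \<open>Pointwise convergence and the passage to bilateral Fourier series\<close>

text \<open>Summability of the coefficients yields some limit of the projections but does not
  identify it. Window averages do: they tend to the same limit and stay close to f, because f is
  close to a Weierstrass polynomial.\<close>

lemma cheb_proj_tendsto:
  assumes f: "continuous_on Omega f" and sm: "summable (\<lambda>k. \<bar>cheb_coeff f k\<bar>)" and x: "x \<in> Omega"
  shows "(\<lambda>m. cheb_proj f m x) \<longlonglongrightarrow> f x"
proof -
  define a where "a = (\<lambda>k. if k = 0 then cheb_coeff f 0 / 2 else cheb_coeff f k * cheb_T k x)"
  have "summable (\<lambda>k. norm (a k))"
    by (rule summable_comparison_test'[OF sm, of 0])
       (auto simp: a_def cheb_T_def abs_mult intro!: mult_left_le)
  hence "a sums suminf a"
    by (rule summable_sums[OF summable_norm_cancel])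
  moreover have "(\<Sum>k\<le>m. a k) = cheb_proj f m x" for m
    by (simp add: atMost_atLeast0 sum.atLeast_Suc_atMost[of 0 m] a_def cheb_proj_def)
  ultimately have lim: "(\<lambda>m. cheb_proj f m x) \<longlonglongrightarrow> suminf a"
    by (simp add: sums_def_le)
  have "\<bar>suminf a - f x\<bar> \<le> e" if e: "e > 0" for e
  proof -
    \<comment> \<open>Against the factor 4 of the window bound, e/8 becomes e/2; the remaining e/2
      is the distance of the projections from their limit.\<close>
    obtain p where p: "\<And>x. x \<in> Omega \<Longrightarrow> \<bar>f x - poly p x\<bar> < e / 8"
      using poly_approx_on_Omega[OF f, of "e/8"] e by auto
    have "\<forall>\<^sub>F m in sequentially. dist (cheb_proj f m x) (suminf a) < e / 2"
      using lim e by (intro tendstoD) auto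
    then obtain n0 where n0: "\<And>m. m \<ge> n0 \<Longrightarrow> \<bar>cheb_proj f m x - suminf a\<bar> < e / 2"
      by (auto simp: eventually_sequentially dist_real_def)
    \<comment> \<open>\<open>Suc\<close> keeps n positive, so that the factor \<open>real n\<close>
      can be cancelled at the end.\<close>
    define n where "n = Suc (max n0 (degree p))"
    have "\<bar>\<Sum>m=n..<2*n. cheb_proj f m x - f x\<bar> \<le> 4 * real n * (e / 8)"
      by (rule sum_cheb_proj_error[OF f _ less_imp_le[OF p] x]) (auto simp: n_def)
    moreover have "\<bar>\<Sum>m=n..<2*n. cheb_proj f m x - suminf a\<bar> \<le> (\<Sum>m=n..<2*n. e / 2)"
      by (rule order_trans[OF sum_abs sum_mono]) (use n0 in \<open>auto simp: n_def less_imp_le\<close>)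
    moreover have "(\<Sum>m=n..<2*n. cheb_proj f m x - f x) - (\<Sum>m=n..<2*n. cheb_proj f m x - suminf a)
        = real n * (suminf a - f x)"
      by (simp add: sum_subtractf algebra_simps)
    ultimately have "\<bar>real n * (suminf a - f x)\<bar> \<le> real n * e"
      by (simp add: field_simps)
    thus ?thesis
      by (simp add: abs_mult n_def)
  qed
  hence "\<bar>suminf a - f x\<bar> \<le> 0"
    using field_le_epsilon[of "\<bar>suminf a - f x\<bar>" 0] by simp
  thus ?thesis
    using lim by simp
qed

lemma has_sum_int_tendsto:
  fixes f :: "int \<Rightarrow> 'b :: {comm_monoid_add, topological_space}"
  assumes "(f has_sum S) UNIV"
  shows "(\<lambda>m. \<Sum>k\<in>{- int m..int m}. f k) \<longlonglongrightarrow> S"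
proof -
  have "filterlim (\<lambda>m. {- int m..int m}) (finite_subsets_at_top UNIV) sequentially"
    unfolding filterlim_finite_subsets_at_top
  proof (intro allI impI)
    fix X :: "int set" assume X: "finite X \<and> X \<subseteq> UNIV"
    define N where "N = (\<Sum>k\<in>X. nat \<bar>k\<bar>)"
    have "\<bar>k\<bar> \<le> int m" if "m \<ge> N" "k \<in> X" for m k
      using member_le_sum[of k X "\<lambda>k. nat \<bar>k\<bar>"] X that by (simp add: N_def)
    hence "X \<subseteq> {- int m..int m}" if "m \<ge> N" for m
      using that by (force simp: abs_le_iff)
    thus "\<forall>\<^sub>F m in sequentially. finite {- int m..int m} \<and> X \<subseteq> {- int m..int m} \<and> {- int m..int m} \<subseteq> UNIV"
      by (auto intro!: eventually_sequentiallyI[of N])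
  qed
  with assms show ?thesis
    unfolding has_sum_def by (rule filterlim_compose)
qed

lemma sum_int_symmetric:
  "(\<Sum>k\<in>{- int m..int m}. f k) = f 0 + (\<Sum>k=1..m. f (int k) + f (- int k))"
proof (induction m)
  case (Suc m)
  have "{- int (Suc m)..int (Suc m)} = insert (int (Suc m)) (insert (- int (Suc m)) {- int m..int m})"
    by auto
  thus ?case
    using Suc by (simp add: add_ac)
qed simp

text \<open>The factor 1/2 serves two purposes: at k = 0 it is the halving in the projection,
  elsewhere it distributes a cosine over the frequencies k and -k.\<close>

lemma fourier_rep_cheb_series:
  assumes h: "continuous_on Omega h" and sm: "summable (\<lambda>k. \<bar>cheb_coeff h k\<bar>)"
  shows "fourier_rep (\<lambda>t. of_real (h (cos t))) (\<lambda>k. of_real (cheb_coeff h (nat \<bar>k\<bar>) / 2))"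
proof -
  define u where "u = (\<lambda>k. complex_of_real (cheb_coeff h (nat \<bar>k\<bar>) / 2))"
  have u: "(\<lambda>k. norm (u k)) summable_on UNIV"
    using summable_divide[OF sm, of 2] by (intro summable_on_int_iff) (auto simp: u_def)
  have "((\<lambda>k. u k * cis (of_int k * t)) has_sum of_real (h (cos t))) UNIV" for t
  proof -
    have "(\<lambda>k. norm (u k * cis (of_int k * t))) summable_on UNIV"
      using u by (simp add: norm_mult)
    hence "(\<lambda>k. u k * cis (of_int k * t)) summable_on UNIV"
      by (rule Infinite_Sum.abs_summable_summable)
    then obtain S where S: "((\<lambda>k. u k * cis (of_int k * t)) has_sum S) UNIV"
      unfolding summable_on_def by blast
    have "(\<Sum>k\<in>{- int m..int m}. u k * cis (of_int k * t)) = of_real (cheb_proj h m (cos t))" for m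
      unfolding sum_int_symmetric cheb_proj_def cheb_T_cos of_real_add of_real_sum
      by (intro arg_cong2[of _ _ _ _ "(+)"] sum.cong refl) (auto simp: u_def complex_eq_iff)
    hence "(\<lambda>m. of_real (cheb_proj h m (cos t))) \<longlonglongrightarrow> S"
      using has_sum_int_tendsto[OF S] by simp
    moreover have "(\<lambda>m. of_real (cheb_proj h m (cos t))) \<longlonglongrightarrow> (of_real (h (cos t)) :: complex)"
      by (intro tendsto_of_real cheb_proj_tendsto h sm) simp
    ultimately show ?thesis
      using S LIMSEQ_unique by blast
  qed
  thus ?thesis
    using u unfolding fourier_rep_def u_def by blast
qed

lemma filterlim_nat_abs_cofinite: "filterlim (\<lambda>k::int. nat \<bar>k\<bar>) at_top cofinite"
  unfolding filterlim_at_top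
proof
  fix Z
  have "{k. \<not> Z \<le> nat \<bar>k\<bar>} \<subseteq> {- int Z..int Z}"
    by auto
  thus "\<forall>\<^sub>F k in cofinite. Z \<le> nat \<bar>k\<bar>"
    unfolding eventually_cofinite by (rule finite_subset) auto
qed

lemma profile_even:
  fixes b :: "nat \<Rightarrow> real"
  assumes "(\<lambda>k. (1 + real k) powr s * b k) \<longlonglongrightarrow> C"
  shows "profile s (\<lambda>k. of_real (b (nat \<bar>k\<bar>) / 2)) (\<lambda>k. of_real (C / 2))"
proof -
  have "((\<lambda>k::int. (1 + real (nat \<bar>k\<bar>)) powr s * b (nat \<bar>k\<bar>)) \<longlongrightarrow> C) cofinite"
    by (rule filterlim_compose[OF assms filterlim_nat_abs_cofinite])
  hence "((\<lambda>k::int. wt s k * (b (nat \<bar>k\<bar>) / 2) - C / 2) \<longlongrightarrow> C / 2 - C / 2) cofinite"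
    by (intro tendsto_diff tendsto_const) (simp add: wt_def tendsto_divide[where b = 2, simplified])
  from tendsto_of_real[OF this, where 'a = complex] show ?thesis
    by (simp add: profile_def)
qed

subsection \<open>Coefficients of the model singularity\<close>

lemma sin_half_sq: "(1 - cos t) / 2 = (sin (t / 2))\<^sup>2" for t :: real
  using cos_double_sin[of "t / 2"] by simp

lemma half_powr_cos: "((1 - cos t) / 2) powr a = \<bar>sin (t / 2)\<bar> powr (2 * a)" for t :: real
proof -
  have "((1 - cos t) / 2) powr a = (\<bar>sin (t / 2)\<bar> powr 2) powr a"
    by (simp add: sin_half_sq powr_numeral del: powr_powr)
  also have "\<dots> = \<bar>sin (t / 2)\<bar> powr (2 * a)"
    by (rule powr_powr)
  finally show ?thesis .
qed

lemma continuous_on_half_powr: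
  assumes "a > 0"
  shows "continuous_on Omega (\<lambda>x. ((1 - x) / 2) powr a)"
  using assms by (intro continuous_on_powr' continuous_intros) auto

text \<open>Obtained by integrating the derivative of (sin ((k+1) t) - sin (k t)) sin (t/2)^(2a),
  which vanishes at both ends. The difference of sines contains a factor sin (t/2) that restores the
  power lowered by differentiation, so only the degrees k and k + 1 survive.\<close>

lemma cheb_coeff_half_powr_rec:
  assumes a: "a > 0"
  defines "w \<equiv> \<lambda>x. ((1 - x) / 2) powr a"
  shows "(real k + 1 + a) * cheb_coeff w (Suc k) = (real k - a) * cheb_coeff w k"
proof -
  have w: "continuous_on Omega w"
    unfolding w_def by (rule continuous_on_half_powr[OF a])
  define B where "B = (\<lambda>t. w (cos t))"
  have B: "B t = sin (t / 2) powr (2 * a)" if "0 \<le> t" "t \<le> pi" for t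
    using that by (simp add: B_def w_def half_powr_cos sin_ge_zero)
  define \<Phi> where "\<Phi> = (\<lambda>t. (sin ((real k + 1) * t) - sin (real k * t)) * B t)"
  define \<Phi>' where "\<Phi>' = (\<lambda>t. (real k + 1 + a) * (B t * cos (real (Suc k) * t)) - (real k - a) * (B t * cos (real k * t)))"
  have "(\<Phi>' has_integral \<Phi> pi - \<Phi> 0) {0..pi}"
  \<comment> \<open>For small a the factor \<open>B\<close> is not differentiable at t = 0, so the
    product rule is applied in the open interval and only continuity is used at the ends.\<close>
  proof (rule fundamental_theorem_of_calculus_interior)
    show "continuous_on {0..pi} \<Phi>"
      unfolding \<Phi>_def B_def by (intro continuous_intros continuous_on_comp_cos w)
    fix t assume t: "t \<in> {0<..<pi}"
    have s: "sin (t / 2) > 0"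
      using t by (intro sin_gt_zero) auto
    have "((\<lambda>t. (sin ((real k + 1) * t) - sin (real k * t)) * sin (t / 2) powr (2 * a)) has_real_derivative
       ((real k + 1) * cos ((real k + 1) * t) - real k * cos (real k * t)) * sin (t / 2) powr (2 * a)
       + (sin ((real k + 1) * t) - sin (real k * t)) * (2 * a * sin (t / 2) powr (2 * a - 1) * (cos (t / 2) / 2))) (at t)"
      using s by (auto intro!: derivative_eq_intros)
    moreover have "(sin ((real k + 1) * t) - sin (real k * t)) * (2 * a * sin (t / 2) powr (2 * a - 1) * (cos (t / 2) / 2))
        = a * (cos ((real k + 1) * t) + cos (real k * t)) * sin (t / 2) powr (2 * a)"
    proof -
      have 1: "sin ((real k + 1) * t) - sin (real k * t) = 2 * sin (t / 2) * cos ((real k + 1 / 2) * t)"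
        using sin_diff_sin[of "(real k + 1) * t" "real k * t"] by (simp add: field_simps)
      have 2: "cos ((real k + 1) * t) + cos (real k * t) = 2 * cos ((real k + 1 / 2) * t) * cos (t / 2)"
        using cos_plus_cos[of "(real k + 1) * t" "real k * t"] by (simp add: field_simps)
      have 3: "sin (t / 2) * sin (t / 2) powr (2 * a - 1) = sin (t / 2) powr (2 * a)"
        using s by (simp add: powr_mult_base)
      show ?thesis
        unfolding 1 2 3[symmetric] by (simp add: mult_ac)
    qed
    ultimately have "((\<lambda>t. (sin ((real k + 1) * t) - sin (real k * t)) * sin (t / 2) powr (2 * a)) has_real_derivative \<Phi>' t) (at t)"
      using t by (simp add: \<Phi>'_def B algebra_simps)
    hence "(\<Phi> has_real_derivative \<Phi>' t) (at t)"
      by (rule has_field_derivative_transform_within_open[where S = "{0<..<pi}"])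
         (use t in \<open>auto simp: \<Phi>_def B\<close>)
    thus "(\<Phi> has_vector_derivative \<Phi>' t) (at t)"
      by (simp add: has_real_derivative_iff_has_vector_derivative)
  qed simp
  moreover have "\<Phi> pi = 0" "\<Phi> 0 = 0"
    using sin_npi[of "Suc k"] by (simp_all add: \<Phi>_def add.commute)
  ultimately have "integral {0..pi} \<Phi>' = 0"
    by (simp add: integral_unique)
  moreover have "integral {0..pi} \<Phi>' = (real k + 1 + a) * integral {0..pi} (\<lambda>t. w (cos t) * cos (real (Suc k) * t))
      - (real k - a) * integral {0..pi} (\<lambda>t. w (cos t) * cos (real k * t))"
    unfolding \<Phi>'_def B_def
    using cheb_coeff_integrable[OF w, of "Suc k"] cheb_coeff_integrable[OF w, of k]
    by (subst integral_diff) (auto intro!: integrable_on_mult_right)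
  ultimately show ?thesis
    by (simp add: cheb_coeff_altdef[OF w] field_simps)
qed

text \<open>The recurrence determines ratios only, so the starting value needs its own argument: it
  integrates a continuous nonnegative function that equals 1 at t = pi.\<close>

lemma cheb_coeff_half_powr_0:
  assumes a: "a > 0"
  shows "cheb_coeff (\<lambda>x. ((1 - x) / 2) powr a) 0 \<noteq> 0"
proof
  define w where "w = (\<lambda>x::real. ((1 - x) / 2) powr a)"
  have w: "continuous_on Omega w"
    unfolding w_def by (rule continuous_on_half_powr[OF a])
  assume "cheb_coeff (\<lambda>x. ((1 - x) / 2) powr a) 0 = 0"
  hence "integral {0..pi} (\<lambda>t. w (cos t)) = 0"
    using cheb_coeff_altdef[OF w, of 0] by (simp add: w_def)
  moreover have "integral {0..pi} (\<lambda>t. w (cos t)) = 0 \<longleftrightarrow> (\<forall>t\<in>{0..pi}. w (cos t) = 0)"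
    by (rule integral_eq_0_iff[OF continuous_on_comp_cos[OF w]]) (auto simp: w_def)
  ultimately have "w (cos pi) = 0"
    by (metis atLeastAtMost_iff order_refl pi_ge_zero)
  thus False
    by (simp add: w_def)
qed

text \<open>The recurrence unrolls to a quotient of Pochhammer symbols, whose growth is given by
  Euler's limit for the reciprocal Gamma function. The constant contains 1/Gamma(-a), which is
  nonzero because a is not a natural number.\<close>

lemma cheb_coeff_half_powr_asymp:
  assumes a: "a > 0" "\<And>n::nat. a \<noteq> real n"
  obtains C where "C \<noteq> 0"
    "(\<lambda>k. (1 + real k) powr (1 + 2 * a) * cheb_coeff (\<lambda>x. ((1 - x) / 2) powr a) k) \<longlonglongrightarrow> C"
proof -
  define b where "b = cheb_coeff (\<lambda>x. ((1 - x) / 2) powr a)"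
  have b: "b k = b 0 * (pochhammer (-a) k / pochhammer (1 + a) k)" for k
  proof (induction k)
    case (Suc k)
    have "pochhammer (1 + a) (Suc k) \<noteq> 0"
      using a(1) by (intro less_imp_neq[symmetric] pochhammer_pos) simp
    hence "(1 + a + real k) \<noteq> 0" "pochhammer (1 + a) k \<noteq> 0"
      by (auto simp: pochhammer_Suc)
    moreover have "(real k + 1 + a) * b (Suc k) = (real k - a) * b k"
      unfolding b_def by (rule cheb_coeff_half_powr_rec[OF a(1)])
    ultimately have "b (Suc k) = (real k - a) / (1 + a + real k) * b k"
      by (simp add: field_simps)
    thus ?case
      unfolding Suc.IH by (simp add: pochhammer_Suc mult_ac)
  qed simp
  have na: "- a \<notin> \<int>\<^sub>\<le>\<^sub>0"
    using a(2) by (auto elim!: nonpos_Ints_cases') 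
  have pa: "1 + a \<notin> \<int>\<^sub>\<le>\<^sub>0"
    using a(1) by (auto elim!: nonpos_Ints_cases')
  define C where "C = b 0 * (rGamma (- a) / rGamma (1 + a))"
  have "C \<noteq> 0"
    using cheb_coeff_half_powr_0[OF a(1)] na pa by (simp add: C_def b_def rGamma_eq_zero_iff)
  moreover have "(\<lambda>k. (1 + real k) powr (1 + 2 * a) * b k) \<longlonglongrightarrow> C"
  proof (rule LIMSEQ_imp_Suc)
    \<comment> \<open>\<open>rGamma_series\<close> at n involves Pochhammer symbols of length n + 1,
      hence the limit along shifted indices; the weight 2 + n and the n inside the series are then
      matched by a factor tending to 1.\<close>
    have 1: "(\<lambda>n. b 0 * (rGamma_series (- a) n / rGamma_series (1 + a) n)) \<longlonglongrightarrow> C"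
      unfolding C_def using pa by (intro tendsto_intros rGamma_series_LIMSEQ) (auto simp: rGamma_eq_zero_iff)
    have 2: "(\<lambda>n. ((2 + real n) / real n) powr (1 + 2 * a)) \<longlonglongrightarrow> 1 powr (1 + 2 * a)"
      by (intro tendsto_powr tendsto_const) (real_asymp | simp)+
    have "(\<lambda>n. ((2 + real n) / real n) powr (1 + 2 * a) * (b 0 * (rGamma_series (- a) n / rGamma_series (1 + a) n))) \<longlonglongrightarrow> C"
      using tendsto_mult[OF 2 1] by simp
    moreover have "\<forall>\<^sub>F n in sequentially. ((2 + real n) / real n) powr (1 + 2 * a) * (b 0 * (rGamma_series (- a) n / rGamma_series (1 + a) n))
       = (1 + real (Suc n)) powr (1 + 2 * a) * b (Suc n)"
      using eventually_gt_at_top[of 0]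
    proof eventually_elim
      case (elim n)
      have "rGamma_series (- a) n / rGamma_series (1 + a) n
          = pochhammer (- a) (Suc n) / pochhammer (1 + a) (Suc n) * (exp ((1 + a) * ln (real n)) / exp (- a * ln (real n)))"
        by (simp add: rGamma_series_def)
      also have "exp ((1 + a) * ln (real n)) / exp (- a * ln (real n)) = real n powr (1 + 2 * a)"
        using elim by (simp add: powr_def exp_diff[symmetric] algebra_simps)
      finally show ?case
        using elim by (simp add: b[of "Suc n"] powr_divide)
    qed
    ultimately show "(\<lambda>n. (1 + real (Suc n)) powr (1 + 2 * a) * b (Suc n)) \<longlonglongrightarrow> C"
      by (rule Lim_transform_eventually)
  qed
  ultimately show ?thesis
    using that by (simp add: b_def)
qed

subsection \<open>Coefficients of smooth functions\<close>

text \<open>The module generated by the derivatives of g over the polynomials in x. It is stable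
  under differentiation and multiplication by x, hence under the operator of the integration by
  parts below, so that step can be iterated without explicit formulas.\<close>

inductive_set diff_module :: "(nat \<Rightarrow> real \<Rightarrow> real) \<Rightarrow> (real \<Rightarrow> real) set" for D where
  base: "D k \<in> diff_module D"
| add: "h1 \<in> diff_module D \<Longrightarrow> h2 \<in> diff_module D \<Longrightarrow> (\<lambda>x. h1 x + h2 x) \<in> diff_module D"
| cmult: "h \<in> diff_module D \<Longrightarrow> (\<lambda>x. c * h x) \<in> diff_module D"
| xmult: "h \<in> diff_module D \<Longrightarrow> (\<lambda>x. x * h x) \<in> diff_module D"

lemma diff_module_deriv:
  assumes D: "\<And>k x. x \<in> S \<Longrightarrow> (D k has_real_derivative D (Suc k) x) (at x within S)"
    and h: "h \<in> diff_module D"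
  shows "\<exists>h'\<in>diff_module D. \<forall>x\<in>S. (h has_real_derivative h' x) (at x within S)"
  using h
proof induction
  case (base k)
  thus ?case using D diff_module.base by blast
next
  case (add h1 h2)
  then obtain h1' h2' where "h1' \<in> diff_module D" "\<forall>x\<in>S. (h1 has_real_derivative h1' x) (at x within S)"
    "h2' \<in> diff_module D" "\<forall>x\<in>S. (h2 has_real_derivative h2' x) (at x within S)" by blast
  thus ?case
    by (intro bexI[of _ "\<lambda>x. h1' x + h2' x"]) (auto intro!: DERIV_add diff_module.add)
next
  case (cmult h c)
  then obtain h' where "h' \<in> diff_module D" "\<forall>x\<in>S. (h has_real_derivative h' x) (at x within S)" by blast
  thus ?case
    by (intro bexI[of _ "\<lambda>x. c * h' x"]) (auto intro!: DERIV_cmult diff_module.cmult)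
next
  case (xmult h)
  then obtain h' where "h' \<in> diff_module D" "\<forall>x\<in>S. (h has_real_derivative h' x) (at x within S)" by blast
  thus ?case using xmult.hyps
    by (intro bexI[of _ "\<lambda>x. h x + x * h' x"])
       (auto intro!: derivative_eq_intros diff_module.intros)
qed

text \<open>In the variable \<open>t = arccos x\<close> the operator \<open>(1 - x\<^sup>2) h'' - x h'\<close> is the second
  derivative, so each application gains a factor \<open>1 / k\<^sup>2\<close>.\<close>
lemma cheb_coeff_second_derivative:
  assumes h: "\<And>x. x \<in> Omega \<Longrightarrow> (h has_real_derivative h1 x) (at x within Omega)"
    and h1: "\<And>x. x \<in> Omega \<Longrightarrow> (h1 has_real_derivative h2 x) (at x within Omega)"
    and h2: "continuous_on Omega h2" and k: "k > 0"
  shows "cheb_coeff h k = - cheb_coeff (\<lambda>x. (1 - x * x) * h2 x - x * h1 x) k / (real k)\<^sup>2"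
proof -
  have c: "continuous_on Omega h" "continuous_on Omega h1"
    by (rule DERIV_continuous_on[OF h], simp, rule DERIV_continuous_on[OF h1], simp)
  define A where "A = (\<lambda>x. (1 - x * x) * h2 x - x * h1 x)"
  have cA: "continuous_on Omega A"
    unfolding A_def by (intro continuous_intros c h2)
  \<comment> \<open>The boundary terms of two integrations by parts in one function; the factors sin
    (k t) and sin t make it vanish at 0 and pi.\<close>
  define \<Phi> where "\<Phi> = (\<lambda>t. real k * (h (cos t) * sin (real k * t)) - sin t * h1 (cos t) * cos (real k * t))"
  define \<Phi>' where "\<Phi>' = (\<lambda>t. (real k)\<^sup>2 * (h (cos t) * cos (real k * t)) + A (cos t) * cos (real k * t))"
  have "(\<Phi>' has_integral \<Phi> pi - \<Phi> 0) {0..pi}"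
  proof (rule fundamental_theorem_of_calculus)
    fix t assume "t \<in> {0..pi}"
    have dcos: "(cos has_real_derivative - sin t) (at t within {0..pi})"
      by (auto intro!: derivative_eq_intros)
    have sub: "cos ` {0..pi} \<subseteq> Omega" by auto
    have d0: "((\<lambda>t. h (cos t)) has_real_derivative h1 (cos t) * (- sin t)) (at t within {0..pi})"
      using DERIV_image_chain[OF DERIV_subset[OF h[OF cos_in_Omega] sub] dcos] by (simp add: o_def)
    have d1: "((\<lambda>t. h1 (cos t)) has_real_derivative h2 (cos t) * (- sin t)) (at t within {0..pi})"
      using DERIV_image_chain[OF DERIV_subset[OF h1[OF cos_in_Omega] sub] dcos] by (simp add: o_def)
    have ss: "1 - cos t * cos t = sin t * sin t"
      using sin_cos_squared_add[of t] by (simp add: power2_eq_square)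
    have "(\<Phi> has_real_derivative \<Phi>' t) (at t within {0..pi})"
      unfolding \<Phi>_def \<Phi>'_def A_def ss
      by (auto intro!: derivative_eq_intros d0 d1 simp: algebra_simps power2_eq_square)
    thus "(\<Phi> has_vector_derivative \<Phi>' t) (at t within {0..pi})"
      by (simp add: has_real_derivative_iff_has_vector_derivative)
  qed simp
  hence "integral {0..pi} \<Phi>' = 0"
    by (simp add: \<Phi>_def integral_unique)
  moreover have "integral {0..pi} \<Phi>' = (real k)\<^sup>2 * integral {0..pi} (\<lambda>t. h (cos t) * cos (real k * t))
     + integral {0..pi} (\<lambda>t. A (cos t) * cos (real k * t))"
    unfolding \<Phi>'_def using cheb_coeff_integrable[OF c(1), of k] cheb_coeff_integrable[OF cA, of k]
    by (subst integral_add) (auto intro!: integrable_on_mult_right)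
  ultimately have "(real k)\<^sup>2 * cheb_coeff h k = - cheb_coeff A k"
    by (simp add: cheb_coeff_altdef[OF c(1)] cheb_coeff_altdef[OF cA] field_simps)
  thus ?thesis
    using k by (simp add: A_def field_simps)
qed

lemma smooth_within_continuous_on:
  assumes "smooth_within g S"
  shows "continuous_on S g"
proof -
  obtain D where D: "\<forall>x\<in>S. D 0 x = g x" "\<And>k x. x \<in> S \<Longrightarrow> (D k has_real_derivative D (Suc k) x) (at x within S)"
    using assms unfolding smooth_within_def by blast
  have "continuous_on S (D 0)"
    by (rule DERIV_continuous_on[OF D(2)])
  thus ?thesis
    using D(1) by (simp cong: continuous_on_cong)
qed

lemma smooth_cheb_coeff_bound:
  assumes "smooth_within g Omega"
  obtains M where "\<And>k. k > 0 \<Longrightarrow> \<bar>cheb_coeff g k\<bar> \<le> M / real k ^ (2 * N)"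
proof -
  obtain D where D: "\<forall>x\<in>Omega. D 0 x = g x" "\<And>k x. x \<in> Omega \<Longrightarrow> (D k has_real_derivative D (Suc k) x) (at x within Omega)"
    using assms unfolding smooth_within_def by blast
  have cont: "continuous_on Omega h" if "h \<in> diff_module D" for h
    using diff_module_deriv[OF D(2) that] DERIV_continuous_on by blast
  have "\<exists>M. \<forall>k>0. \<bar>cheb_coeff h k\<bar> \<le> M / real k ^ (2 * N)" if "h \<in> diff_module D" for h
    using that
  proof (induction N arbitrary: h)
    case 0
    have "bounded (h ` Omega)"
      by (intro compact_imp_bounded compact_continuous_image cont[OF 0]) simp
    then obtain M where "\<And>x. x \<in> Omega \<Longrightarrow> \<bar>h x\<bar> \<le> M"
      unfolding bounded_iff by (auto simp del: atLeastAtMost_iff)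
    from cheb_coeff_bound[OF cont[OF 0] this] show ?case by auto
  next
    case (Suc N)
    obtain h1 where h1: "h1 \<in> diff_module D" "\<forall>x\<in>Omega. (h has_real_derivative h1 x) (at x within Omega)"
      using diff_module_deriv[OF D(2) Suc.prems] by blast
    obtain h2 where h2: "h2 \<in> diff_module D" "\<forall>x\<in>Omega. (h1 has_real_derivative h2 x) (at x within Omega)"
      using diff_module_deriv[OF D(2) h1(1)] by blast
    define A where "A = (\<lambda>x. (1 - x * x) * h2 x - x * h1 x)"
    have "A = (\<lambda>x. (h2 x + (-1) * (x * (x * h2 x))) + (-1) * (x * h1 x))"
      by (simp add: A_def algebra_simps)
    moreover have "\<dots> \<in> diff_module D"
      by (intro diff_module.add diff_module.cmult diff_module.xmult h1 h2)
    ultimately have "A \<in> diff_module D"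
      by simp
    then obtain M where M: "\<And>k. k > 0 \<Longrightarrow> \<bar>cheb_coeff A k\<bar> \<le> M / real k ^ (2 * N)"
      using Suc.IH by blast
    have "\<bar>cheb_coeff h k\<bar> \<le> M / real k ^ (2 * Suc N)" if k: "k > 0" for k
    proof -
      have "cheb_coeff h k = - cheb_coeff A k / (real k)\<^sup>2"
        unfolding A_def using h1 h2 k by (intro cheb_coeff_second_derivative cont) auto
      hence "\<bar>cheb_coeff h k\<bar> = \<bar>cheb_coeff A k\<bar> / (real k)\<^sup>2"
        by simp
      also have "\<dots> \<le> M / real k ^ (2 * N) / (real k)\<^sup>2"
        by (intro divide_right_mono M k) simp
      finally show ?thesis
        by (simp add: power_add power2_eq_square field_simps)
    qed
    thus ?case by blast
  qed
  then obtain M where "\<forall>k>0. \<bar>cheb_coeff (D 0) k\<bar> \<le> M / real k ^ (2 * N)"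
    using diff_module.base by blast
  moreover have "cheb_coeff (D 0) k = cheb_coeff g k" for k
    using D(1) by (intro cheb_coeff_cong) auto
  ultimately show ?thesis using that[of M] by simp
qed

lemma smooth_cheb_coeff_rapid:
  assumes "smooth_within g Omega"
  shows "(\<lambda>k. (1 + real k) powr s * cheb_coeff g k) \<longlonglongrightarrow> 0"
proof -
  define c where "c = nat \<lceil>\<bar>s\<bar>\<rceil>"
  define N where "N = c + 1"
  obtain M where M: "\<And>k. k > 0 \<Longrightarrow> \<bar>cheb_coeff g k\<bar> \<le> M / real k ^ (2 * N)"
    using smooth_cheb_coeff_bound[OF assms] by blast
  have "\<bar>s\<bar> \<le> real c"
    unfolding c_def by (rule real_nat_ceiling_ge)
  hence sN: "s < real (2 * N)"
    by (simp add: N_def)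
  have "(\<lambda>k. (1 + real k) powr s / real k powr real (2 * N)) \<longlonglongrightarrow> 0"
    using sN by real_asymp
  hence lim: "(\<lambda>k. (1 + real k) powr s / real k powr real (2 * N) * M) \<longlonglongrightarrow> 0"
    using tendsto_mult_left_zero by blast
  show ?thesis
  proof (rule tendsto_0_le[OF lim, of _ 1])
    show "\<forall>\<^sub>F k in sequentially. norm ((1 + real k) powr s * cheb_coeff g k)
        \<le> norm ((1 + real k) powr s / real k powr real (2 * N) * M) * 1"
      using eventually_gt_at_top[of 0]
    proof eventually_elim
      case (elim k)
      have "\<bar>cheb_coeff g k\<bar> \<le> \<bar>M\<bar> / real k ^ (2 * N)"
        using M[OF elim] by (rule order_trans) (simp add: divide_right_mono)
      from mult_left_mono[OF this, of "(1 + real k) powr s"] elim show ?case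
        by (simp add: abs_mult powr_realpow del: of_nat_mult)
    qed
  qed
qed

subsection \<open>Coefficients of the model function\<close>

lemma weighted_bound:
  fixes b :: "nat \<Rightarrow> real"
  assumes "Bseq (\<lambda>k. (1 + real k) powr s * b k)"
  obtains K where "K > 0" "\<And>k. \<bar>b k\<bar> \<le> K * (1 + real k) powr (- s)"
proof -
  obtain K where K: "K > 0" "\<And>k. \<bar>(1 + real k) powr s * b k\<bar> \<le> K"
    using assms unfolding Bseq_def by auto
  have "\<bar>b k\<bar> \<le> K * (1 + real k) powr (- s)" for k
    using K(2)[of k] by (simp add: abs_mult powr_minus divide_simps mult_ac)
  with K(1) that show ?thesis by blast
qed

lemma summable_weighted:
  fixes b :: "nat \<Rightarrow> real"
  assumes "Bseq (\<lambda>k. (1 + real k) powr s * b k)" "s > 1"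
  shows "summable (\<lambda>k. \<bar>b k\<bar>)"
proof -
  obtain K where K: "\<And>k. \<bar>b k\<bar> \<le> K * (1 + real k) powr (- s)"
    using weighted_bound[OF assms(1)] by blast
  have "summable (\<lambda>k. real (Suc k) powr (- s))"
    using assms(2) by (subst summable_Suc_iff) (simp add: summable_real_powr_iff)
  hence "summable (\<lambda>k. K * (1 + real k) powr (- s))"
    by (intro summable_mult) simp
  thus ?thesis
    by (rule summable_comparison_test') (use K in auto)
qed

lemma sin_powr_rep:
  assumes \<beta>: "\<beta> > 0" "\<And>n::nat. \<beta> \<noteq> 2 * real n"
  obtains u C where "C \<noteq> 0" "fourier_rep (\<lambda>t. of_real (\<bar>sin (t / 2)\<bar> powr \<beta>)) u"
    "profile (1 + \<beta>) u (\<lambda>k. of_real C)"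
proof -
  define w where "w = (\<lambda>x::real. ((1 - x) / 2) powr (\<beta> / 2))"
  have "\<beta> / 2 \<noteq> real n" for n
    using \<beta>(2)[of n] by auto
  then obtain C where C: "C \<noteq> 0" "(\<lambda>k. (1 + real k) powr (1 + \<beta>) * cheb_coeff w k) \<longlonglongrightarrow> C"
    using cheb_coeff_half_powr_asymp[of "\<beta> / 2"] \<beta>(1) by (auto simp: w_def)
  have w: "continuous_on Omega w"
    unfolding w_def using \<beta>(1) by (intro continuous_on_half_powr) simp
  have "summable (\<lambda>k. \<bar>cheb_coeff w k\<bar>)"
    using \<beta>(1) C(2) by (intro summable_weighted[of "1 + \<beta>"] convergent_imp_Bseq) (auto simp: convergent_def)
  from fourier_rep_cheb_series[OF w this]
  have "fourier_rep (\<lambda>t. of_real (\<bar>sin (t / 2)\<bar> powr \<beta>)) (\<lambda>k. of_real (cheb_coeff w (nat \<bar>k\<bar>) / 2))"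
    by (simp add: w_def half_powr_cos)
  thus ?thesis
    using that[of "C / 2"] C(1) profile_even[OF C(2)] by simp
qed

lemma smooth_rep:
  assumes "smooth_within g Omega"
  obtains v where "fourier_rep (\<lambda>t. of_real (g (cos t))) v" "\<And>s. profile s v (\<lambda>k. 0)"
proof -
  have "summable (\<lambda>k. \<bar>cheb_coeff g k\<bar>)"
    using smooth_cheb_coeff_rapid[OF assms, of 2]
    by (intro summable_weighted[of 2] convergent_imp_Bseq) (auto simp: convergent_def)
  from fourier_rep_cheb_series[OF smooth_within_continuous_on[OF assms] this]
  show ?thesis
    by (rule that) (use profile_even[OF smooth_cheb_coeff_rapid[OF assms]] in simp)
qed

lemma profile_modulate:
  assumes "profile s u P"
  shows "profile s (\<lambda>k. u k * cis (- (of_int k * \<phi>))) (\<lambda>k. P k * cis (- (of_int k * \<phi>)))"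
proof -
  obtain B where "\<And>k. norm (P k) \<le> B"
    using assms unfolding profile_def bounded_iff by blast
  hence "bounded (range (\<lambda>k. P k * cis (- (of_int k * \<phi>))))"
    unfolding bounded_iff by (auto simp: norm_mult)
  moreover have "((\<lambda>k. of_real (wt s k) * (u k * cis (- (of_int k * \<phi>))) - P k * cis (- (of_int k * \<phi>))) \<longlongrightarrow> 0) cofinite"
  proof (rule tendsto_0_le)
    show "((\<lambda>k. of_real (wt s k) * u k - P k) \<longlongrightarrow> 0) cofinite"
      using assms by (simp add: profile_def)
    have "of_real (wt s k) * (u k * cis (- (of_int k * \<phi>))) - P k * cis (- (of_int k * \<phi>))
       = (of_real (wt s k) * u k - P k) * cis (- (of_int k * \<phi>))" for k
      by (simp add: algebra_simps)
    thus "\<forall>\<^sub>F k in cofinite. norm (of_real (wt s k) * (u k * cis (- (of_int k * \<phi>))) - P k * cis (- (of_int k * \<phi>)))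
        \<le> norm (of_real (wt s k) * u k - P k) * 1"
      by (simp add: norm_mult)
  qed
  ultimately show ?thesis
    by (simp add: profile_def)
qed

lemma profile_cmult:
  assumes "profile s u P"
  shows "profile s (\<lambda>k. c * u k) (\<lambda>k. c * P k)"
proof -
  obtain B where "\<And>k. norm (P k) \<le> B"
    using assms unfolding profile_def bounded_iff by blast
  hence "norm (c * P k) \<le> norm c * B" for k
    by (simp add: norm_mult mult_left_mono)
  hence "bounded (range (\<lambda>k. c * P k))"
    unfolding bounded_iff by auto
  moreover have "((\<lambda>k. c * (of_real (wt s k) * u k - P k)) \<longlongrightarrow> c * 0) cofinite"
    using assms by (intro tendsto_mult tendsto_const) (simp add: profile_def)
  hence "((\<lambda>k. of_real (wt s k) * (c * u k) - c * P k) \<longlongrightarrow> 0) cofinite"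
    by (simp add: algebra_simps)
  ultimately show ?thesis
    by (simp add: profile_def)
qed

text \<open>Characters are eigenfunctions of convolution, and the eigenvalue is the value of
  \<open>G\<close> at the point that the character encodes. This turns the sums in
  \<open>conv_profile\<close> into point evaluations.\<close>

lemma has_sum_cis_shift:
  assumes "fourier_rep G v"
  shows "((\<lambda>j. C * cis (- (of_int (k - j) * \<phi>)) * v j) has_sum C * cis (- (of_int k * \<phi>)) * G \<phi>) UNIV"
proof -
  have "C * cis (- (of_int (k - j) * \<phi>)) * v j = C * cis (- (of_int k * \<phi>)) * (v j * cis (of_int j * \<phi>))" for j
  proof -
    have "cis (- (of_int (k - j) * \<phi>)) = cis (- (of_int k * \<phi>)) * cis (of_int j * \<phi>)"
      unfolding cis_mult by (simp add: algebra_simps)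
    thus ?thesis by simp
  qed
  thus ?thesis
    using assms unfolding fourier_rep_def by (simp only: has_sum_cmult_right)
qed

lemma cos_eq_cis: "complex_of_real (c * cos x) = of_real (c / 2) * cis (- x) + of_real (c / 2) * cis x"
  by (simp add: complex_eq_iff)

lemma abs_cos_diff: "\<bar>cos t - cos s\<bar> = 2 * \<bar>sin ((t - s) / 2)\<bar> * \<bar>sin ((t + s) / 2)\<bar>" for s t :: real
proof -
  have "\<bar>sin ((s - t) / 2)\<bar> = \<bar>sin ((t - s) / 2)\<bar>"
    using sin_minus[of "(t - s) / 2"] by (simp add: minus_divide_left)
  thus ?thesis
    by (simp add: cos_diff_cos abs_mult)
qed

text \<open>The two sine factors are singular at the distinct points t0 and -t0 of the circle. Each
  singularity contributes a character, and by symmetry both have the same amplitude, so that they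
  add up to a cosine.\<close>

lemma singular_rep_interior:
  assumes t0: "0 < t0" "t0 < pi" and \<alpha>: "\<alpha> > 0" "\<And>n::nat. \<alpha> \<noteq> 2 * real n"
  obtains u c where "c \<noteq> 0" "fourier_rep (\<lambda>t. of_real (\<bar>cos t - cos t0\<bar> powr \<alpha>)) u"
    "profile (1 + \<alpha>) u (\<lambda>k. of_real (c * cos (of_int k * t0)))"
proof -
  define B where "B = (\<lambda>t. complex_of_real (\<bar>sin (t / 2)\<bar> powr \<alpha>))"
  obtain b C where b: "C \<noteq> 0" "fourier_rep B b" "profile (1 + \<alpha>) b (\<lambda>k. of_real C)"
    using sin_powr_rep[OF \<alpha>] unfolding B_def by blast
  define u1 where "u1 = (\<lambda>k. b k * cis (- (of_int k * t0)))"
  define u2 where "u2 = (\<lambda>k. b k * cis (- (of_int k * (- t0))))"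
  have r1: "fourier_rep (\<lambda>t. B (t - t0)) u1" and r2: "fourier_rep (\<lambda>t. B (t - (- t0))) u2"
    unfolding u1_def u2_def by (intro fourier_rep_shift b)+
  have p1: "profile (1 + \<alpha>) u1 (\<lambda>k. of_real C * cis (- (of_int k * t0)))"
    and p2: "profile (1 + \<alpha>) u2 (\<lambda>k. of_real C * cis (- (of_int k * (- t0))))"
    unfolding u1_def u2_def by (intro profile_modulate b)+
  \<comment> \<open>The value of either factor at the singular point of the other: the points are 2
    t0 apart and the sine takes half the angle. It is positive because t0 is interior.\<close>
  define A where "A = \<bar>sin t0\<bar> powr \<alpha>"
  have "(\<Sum>\<^sub>\<infinity>j. of_real C * cis (- (of_int (k - j) * t0)) * u2 j)
      + (\<Sum>\<^sub>\<infinity>j. of_real C * cis (- (of_int (k - j) * (- t0))) * u1 j) = of_real ((2 * C * A) * cos (of_int k * t0))" for k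
    unfolding infsumI[OF has_sum_cis_shift[OF r1]] infsumI[OF has_sum_cis_shift[OF r2]]
    by (simp add: B_def A_def cos_eq_cis complex_eq_iff)
  with conv_profile[OF p1 p2] \<alpha>(1)
  have "profile (1 + \<alpha>) (conv u1 u2) (\<lambda>k. of_real ((2 * C * A) * cos (of_int k * t0)))"
    by simp
  from profile_cmult[OF this, of "of_real (2 powr \<alpha>)"]
  have p: "profile (1 + \<alpha>) (\<lambda>k. of_real (2 powr \<alpha>) * conv u1 u2 k) (\<lambda>k. of_real ((2 powr \<alpha> * (2 * C * A)) * cos (of_int k * t0)))"
    by (simp add: mult_ac)
  have eq: "of_real (2 powr \<alpha>) * (B (t - t0) * B (t - (- t0))) = complex_of_real (\<bar>cos t - cos t0\<bar> powr \<alpha>)" for t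
    by (simp add: B_def abs_cos_diff powr_mult)
  have r: "fourier_rep (\<lambda>t. of_real (\<bar>cos t - cos t0\<bar> powr \<alpha>)) (\<lambda>k. of_real (2 powr \<alpha>) * conv u1 u2 k)"
    using fourier_rep_cmult[OF fourier_rep_mult[OF r1 r2], of "of_real (2 powr \<alpha>)"] unfolding eq .
  have "sin t0 > 0"
    using t0 by (rule sin_gt_zero)
  hence "2 powr \<alpha> * (2 * C * A) \<noteq> 0"
    using b(1) by (simp add: A_def)
  from that[OF this r p] show ?thesis .
qed

lemma singular_rep_endpoint:
  assumes t0: "t0 = 0 \<or> t0 = pi" and \<alpha>: "\<alpha> > 0" "\<And>n::nat. \<alpha> \<noteq> real n"
  obtains u c where "c \<noteq> 0" "fourier_rep (\<lambda>t. of_real (\<bar>cos t - cos t0\<bar> powr \<alpha>)) u"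
    "profile (1 + 2 * \<alpha>) u (\<lambda>k. of_real (c * cos (of_int k * t0)))"
proof -
  define B where "B = (\<lambda>t. complex_of_real (\<bar>sin (t / 2)\<bar> powr (2 * \<alpha>)))"
  have "2 * \<alpha> > 0" "2 * \<alpha> \<noteq> 2 * real n" for n
    using \<alpha> by auto
  then obtain b C where b: "C \<noteq> 0" "fourier_rep B b" "profile (1 + 2 * \<alpha>) b (\<lambda>k. of_real C)"
    using sin_powr_rep[of "2 * \<alpha>"] unfolding B_def by blast
  define u where "u = (\<lambda>k. of_real (2 powr \<alpha>) * (b k * cis (- (of_int k * t0))))"
  have "\<bar>sin ((t + t0) / 2)\<bar> = \<bar>sin ((t - t0) / 2)\<bar>" for t
    using t0 by (auto simp: add_divide_distrib diff_divide_distrib sin_add sin_diff)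
  hence "\<bar>cos t - cos t0\<bar> = 2 * (\<bar>sin ((t - t0) / 2)\<bar> powr 2)" for t
    unfolding abs_cos_diff by (simp add: power2_eq_square)
  hence eq: "of_real (2 powr \<alpha>) * B (t - t0) = complex_of_real (\<bar>cos t - cos t0\<bar> powr \<alpha>)" for t
    by (simp only: B_def powr_mult powr_powr of_real_mult)
  have r: "fourier_rep (\<lambda>t. of_real (\<bar>cos t - cos t0\<bar> powr \<alpha>)) u"
    using fourier_rep_cmult[OF fourier_rep_shift[OF b(2), of t0], of "of_real (2 powr \<alpha>)"] unfolding eq u_def .
  \<comment> \<open>Since k t0 is a multiple of pi, the modulating character is real and equals the
    cosine, which gives the same shape of profile as in the interior case.\<close>
  have "sin (of_int k * t0) = 0" for k
    using t0 sin_zero_iff_int2[of "of_int k * t0"] by auto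
  hence "cis (- (of_int k * t0)) = of_real (cos (of_int k * t0))" for k
    by (simp add: complex_eq_iff)
  hence p: "profile (1 + 2 * \<alpha>) u (\<lambda>k. of_real ((2 powr \<alpha> * C) * cos (of_int k * t0)))"
    using profile_cmult[OF profile_modulate[OF b(3), of t0], of "of_real (2 powr \<alpha>)"]
    by (simp add: u_def mult_ac)
  have "2 powr \<alpha> * C \<noteq> 0"
    using b(1) by simp
  from that[OF this r p] show ?thesis .
qed

section \<open>From Fourier coefficients back to Chebyshev coefficients\<close>

text \<open>Convolution produces some representing sequence, while \<open>cheb_coeff\<close> is an
  integral; this is the uniqueness statement that links them. It rests on uniform convergence of the
  cosine partial sums.\<close>

lemma fourier_rep_cosine_series:
  assumes f: "continuous_on Omega f" and rep: "fourier_rep (\<lambda>t. of_real (f (cos t))) u"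
  shows "cheb_coeff f k = Re (u (int k)) + Re (u (- int k))"
proof -
  define a where "a = (\<lambda>k. Re (u (int k)) + Re (u (- int k)))"
  have u: "(\<lambda>k. norm (u k)) summable_on UNIV"
    using rep by (simp add: fourier_rep_def)
  have sm: "summable (\<lambda>k. \<bar>a k\<bar>)"
  proof -
    have "summable (\<lambda>k. norm (u (int k)))" "summable (\<lambda>k. norm (u (- int k)))"
      using summable_on_subset_banach[OF u, of "range int"]
        summable_on_subset_banach[OF u, of "range (\<lambda>n. - int n)"]
      by (auto simp: summable_on_reindex inj_on_def o_def summable_on_UNIV_nonneg_real_iff)
    hence "summable (\<lambda>k. norm (u (int k)) + norm (u (- int k)))"
      by (rule summable_add)
    thus ?thesis
      by (rule summable_comparison_test')
         (auto simp: a_def intro!: order_trans[OF abs_triangle_ineq add_mono[OF abs_Re_le_cmod abs_Re_le_cmod]])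
  qed
  define q where "q = (\<lambda>m x. \<Sum>j\<le>m. (if j = 0 then a 0 / 2 else a j) * cheb_T j x)"
  have lim: "(\<lambda>m. q m (cos t)) \<longlonglongrightarrow> f (cos t)" for t
  proof -
    define S where "S = (\<lambda>t m. Re (\<Sum>k\<in>{- int m..int m}. u k * cis (of_int k * t)))"
    have L: "S t \<longlonglongrightarrow> f (cos t)" for t
      unfolding S_def using rep
      by (intro tendsto_Re[where a = "of_real (f (cos t))", simplified] has_sum_int_tendsto) (simp add: fourier_rep_def)
    \<comment> \<open>The sequence u is not assumed real or even. Taking real parts and averaging
      over t and -t removes the sine terms without changing the limit.\<close>
    have "(\<lambda>m. (S t m + S (- t) m) / 2) \<longlonglongrightarrow> (f (cos t) + f (cos (- t))) / 2"
      by (intro tendsto_intros L) simp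
    moreover have "(S t m + S (- t) m) / 2 = q m (cos t)" for m
    proof -
      have "(S t m + S (- t) m) / 2 = a 0 / 2 + (\<Sum>j=1..m. a j * cos (real j * t))"
        unfolding S_def sum_int_symmetric
        by (simp add: a_def sum.distrib[symmetric] sum_distrib_left sum_divide_distrib add_divide_distrib[symmetric] algebra_simps)
      also have "\<dots> = q m (cos t)"
        unfolding q_def atMost_atLeast0 by (subst (2) sum.atLeast_Suc_atMost) (auto simp: cheb_T_cos)
      finally show ?thesis .
    qed
    ultimately show ?thesis by simp
  qed
  \<comment> \<open>The absolute tail bounds f - q m uniformly in x, and
    \<open>cheb_coeff_bound\<close> passes this on to every coefficient.\<close>
  define T where "T = (\<lambda>m. \<Sum>j. \<bar>a (j + Suc m)\<bar>)"
  have T: "T \<longlonglongrightarrow> 0"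
    unfolding T_def using LIMSEQ_Suc[OF suminf_exist_split2[OF sm]] by simp
  have bound: "\<bar>f x - q m x\<bar> \<le> T m" if x: "x \<in> Omega" for x m
  proof -
    have "\<bar>q n x - q m x\<bar> \<le> T m" if "n \<ge> m" for n
    proof -
      have "q n x - q m x = (\<Sum>j\<in>{Suc m..n}. a j * cheb_T j x)"
      proof -
        have "{..n} = {..m} \<union> {Suc m..n}" using that by auto
        hence "q n x = q m x + (\<Sum>j\<in>{Suc m..n}. (if j = 0 then a 0 / 2 else a j) * cheb_T j x)"
          unfolding q_def by (simp only:) (rule sum.union_disjoint, auto)
        also have "(\<Sum>j\<in>{Suc m..n}. (if j = 0 then a 0 / 2 else a j) * cheb_T j x) = (\<Sum>j\<in>{Suc m..n}. a j * cheb_T j x)"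
          by (rule sum.cong) auto
        finally show ?thesis by simp
      qed
      also have "\<bar>\<dots>\<bar> \<le> (\<Sum>j\<in>{Suc m..n}. \<bar>a j\<bar>)"
        by (rule order_trans[OF sum_abs sum_mono]) (auto simp: abs_mult cheb_T_def intro!: mult_left_le)
      also have "\<dots> = (\<Sum>i<n - m. \<bar>a (i + Suc m)\<bar>)"
        by (rule sum.reindex_bij_witness[of _ "\<lambda>i. i + Suc m" "\<lambda>j. j - Suc m"]) auto
      also have "\<dots> \<le> T m"
        unfolding T_def by (rule sum_le_suminf[OF summable_ignore_initial_segment[OF sm]]) auto
      finally show ?thesis .
    qed
    moreover have "(\<lambda>n. \<bar>q n x - q m x\<bar>) \<longlonglongrightarrow> \<bar>f x - q m x\<bar>"
      using lim[of "arccos x"] x by (intro tendsto_intros) (simp add: cos_arccos)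
    ultimately show ?thesis
      by (intro LIMSEQ_le_const2[of "\<lambda>n. \<bar>q n x - q m x\<bar>"]) auto
  qed
  have q: "continuous_on Omega (q m)" for m
    unfolding q_def by (intro continuous_intros continuous_on_cheb_T)
  have "\<bar>cheb_coeff f k - a k\<bar> \<le> 2 * T m" if "m \<ge> k" for m
  proof -
    have "cheb_coeff (q m) k = a k"
      unfolding q_def cheb_coeff_cosine_sum using that by simp
    moreover have "cheb_coeff (\<lambda>x. f x - q m x) k = cheb_coeff f k - cheb_coeff (q m) k"
      by (rule cheb_coeff_diff[OF f q])
    moreover have "\<bar>cheb_coeff (\<lambda>x. f x - q m x) k\<bar> \<le> 2 * T m"
      by (rule cheb_coeff_bound) (intro continuous_intros f q bound | assumption)+
    ultimately show ?thesis by simp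
  qed
  moreover have "(\<lambda>m. 2 * T m) \<longlonglongrightarrow> 0"
    using tendsto_mult_left[OF T, of 2] by simp
  ultimately have "\<bar>cheb_coeff f k - a k\<bar> \<le> 0"
    by (intro LIMSEQ_le_const[of "\<lambda>m. 2 * T m"]) auto
  thus ?thesis by (simp add: a_def)
qed

lemma profile_nat:
  assumes "profile s u P"
  shows "(\<lambda>k. (1 + real k) powr s * (Re (u (int k)) + Re (u (- int k))) - (Re (P (int k)) + Re (P (- int k)))) \<longlonglongrightarrow> 0"
proof -
  have lim: "((\<lambda>k. Re (of_real (wt s k) * u k - P k)) \<longlongrightarrow> Re 0) cofinite"
    using assms by (intro tendsto_Re) (simp add: profile_def)
  have "filterlim h cofinite sequentially" if "inj h" for h :: "nat \<Rightarrow> int"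
    unfolding filterlim_iff eventually_cofinite cofinite_eq_sequentially[symmetric]
  proof (intro allI impI)
    fix P :: "int \<Rightarrow> bool" assume "finite {k. \<not> P k}"
    from finite_vimageI[OF this that] show "finite {n. \<not> P (h n)}"
      by (simp add: vimage_def)
  qed
  hence "filterlim int cofinite sequentially" "filterlim (\<lambda>k. - int k) cofinite sequentially"
    by (simp_all add: inj_on_def)
  from tendsto_add[OF filterlim_compose[OF lim this(1)] filterlim_compose[OF lim this(2)]]
  show ?thesis
    by (simp add: wt_def algebra_simps)
qed

lemma continuous_on_model_function:
  assumes "\<alpha> > 0" "continuous_on Omega g"
  shows "continuous_on Omega (model_function \<xi> \<alpha> g)"
  unfolding model_function_def[abs_def] using assms
  by (intro continuous_intros continuous_on_powr') auto

lemma model_function_coeff_asymp: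
  assumes \<xi>: "\<xi> \<in> Omega" and \<alpha>: "admissible_exponent \<xi> \<alpha>" and g: "smooth_within g Omega" and g\<xi>: "g \<xi> \<noteq> 0"
  obtains \<beta> c where "\<beta> > 0" "c \<noteq> 0"
    "(\<lambda>k. (1 + real k) powr (1 + \<beta>) * cheb_coeff (model_function \<xi> \<alpha> g) k - c * cos (real k * arccos \<xi>)) \<longlonglongrightarrow> 0"
proof -
  define t0 where "t0 = arccos \<xi>"
  have t0: "cos t0 = \<xi>" "0 \<le> t0" "t0 \<le> pi"
    using \<xi> by (auto simp: t0_def cos_arccos arccos_lbound arccos_ubound)
  have pos: "\<alpha> > 0"
    using \<alpha> by (simp add: admissible_exponent_def)
  have "\<exists>\<beta>>0. \<exists>u c. c \<noteq> 0 \<and> fourier_rep (\<lambda>t. of_real (\<bar>cos t - cos t0\<bar> powr \<alpha>)) u \<and>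
      profile (1 + \<beta>) u (\<lambda>k. of_real (c * cos (of_int k * t0)))"
  proof (cases "\<xi> \<in> {-1<..<1}")
    case True
    hence "0 < t0" "t0 < pi"
      by (auto simp: t0_def arccos_lt_bounded)
    moreover have "\<alpha> \<noteq> 2 * real n" for n
    proof
      assume "\<alpha> = 2 * real n"
      hence "even (2 * int n)" "\<alpha> = of_int (2 * int n)" by auto
      thus False
        using \<alpha> True unfolding admissible_exponent_def by blast
    qed
    ultimately show ?thesis
      using singular_rep_interior[of t0 \<alpha>] pos by metis
  next
    case False
    hence \<xi>': "\<xi> = -1 \<or> \<xi> = 1"
      using \<xi> by auto
    hence "t0 = 0 \<or> t0 = pi"
      by (auto simp: t0_def)
    moreover have "\<alpha> \<notin> \<int>"
      using \<alpha> \<xi>' by (auto simp: admissible_exponent_def)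
    hence "\<alpha> \<noteq> real n" for n
      by auto
    ultimately show ?thesis
      using singular_rep_endpoint[of t0 \<alpha>] pos by (metis mult_pos_pos zero_less_numeral)
  qed
  then obtain \<beta> u c where u: "\<beta> > 0" "c \<noteq> 0" "fourier_rep (\<lambda>t. of_real (\<bar>cos t - cos t0\<bar> powr \<alpha>)) u"
     "profile (1 + \<beta>) u (\<lambda>k. of_real (c * cos (of_int k * t0)))" by blast
  obtain v where v: "fourier_rep (\<lambda>t. of_real (g (cos t))) v" "profile (1 + \<beta>) v (\<lambda>k. 0)"
    using smooth_rep[OF g] by metis
  have rep: "fourier_rep (\<lambda>t. of_real (model_function \<xi> \<alpha> g (cos t))) (conv u v)"
    using fourier_rep_mult[OF u(3) v(1)] by (simp add: model_function_def t0)
  \<comment> \<open>Both characters in the cosine are multiplied by g at the same point, since cos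
    t0 = cos (-t0) = \<xi>. The second sum of \<open>conv_profile\<close> vanishes because v has
    profile 0.\<close>
  have "(\<Sum>\<^sub>\<infinity>j. of_real (c * cos (of_int (k - j) * t0)) * v j) = of_real (c * g \<xi> * cos (of_int k * t0))" for k
  proof -
    have "((\<lambda>j. of_real (c / 2) * cis (- (of_int (k - j) * t0)) * v j + of_real (c / 2) * cis (- (of_int (k - j) * (- t0))) * v j)
      has_sum (of_real (c / 2) * cis (- (of_int k * t0)) * of_real (g (cos t0))
        + of_real (c / 2) * cis (- (of_int k * (- t0))) * of_real (g (cos (- t0))))) UNIV"
      by (intro has_sum_add has_sum_cis_shift[OF v(1)])
    from infsumI[OF this] show ?thesis
      unfolding cos_eq_cis by (simp add: distrib_right distrib_left t0 mult_ac)
  qed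
  with conv_profile[OF u(4) v(2)] u(1)
  have p: "profile (1 + \<beta>) (conv u v) (\<lambda>k. of_real (c * g \<xi> * cos (of_int k * t0)))"
    by simp
  have "continuous_on Omega (model_function \<xi> \<alpha> g)"
    by (intro continuous_on_model_function pos smooth_within_continuous_on g)
  \<comment> \<open>The factor 2 collects the equal contributions of k and -k.\<close>
  from fourier_rep_cosine_series[OF this rep] profile_nat[OF p]
  have "(\<lambda>k. (1 + real k) powr (1 + \<beta>) * cheb_coeff (model_function \<xi> \<alpha> g) k - (2 * (c * g \<xi>)) * cos (real k * t0)) \<longlonglongrightarrow> 0"
    by (simp add: algebra_simps)
  moreover have "2 * (c * g \<xi>) \<noteq> 0"
    using u(2) g\<xi> by simp
  ultimately show ?thesis
    using that[OF u(1)] unfolding t0_def by blast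
qed

subsection \<open>Pointwise asymptotics of the projection error\<close>

text \<open>Asymptotically \<open>\<beta> k powr (- \<beta> - 1)\<close>, but with tails that telescope.\<close>
definition pdiff :: "real \<Rightarrow> nat \<Rightarrow> real" where
  "pdiff \<beta> k = (1 + real k) powr (- \<beta>) - (2 + real k) powr (- \<beta>)"

lemma pdiff_pos: "\<beta> > 0 \<Longrightarrow> pdiff \<beta> k > 0"
  by (simp add: pdiff_def powr_less_mono2_neg)

lemma pdiff_asymp:
  assumes "\<beta> > 0"
  shows "(\<lambda>k. (1 + real k) powr (1 + \<beta>) * pdiff \<beta> k) \<longlonglongrightarrow> \<beta>"
  unfolding pdiff_def using assms by real_asymp

lemma pdiff_ratio:
  assumes "\<beta> > 0"
  shows "(\<lambda>k. pdiff \<beta> (Suc k) / pdiff \<beta> k) \<longlonglongrightarrow> 1"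
proof -
  have "(\<lambda>k. ((1 + real (Suc k)) powr (1 + \<beta>) * pdiff \<beta> (Suc k)) / ((1 + real k) powr (1 + \<beta>) * pdiff \<beta> k)
     * ((1 + real k) / (2 + real k)) powr (1 + \<beta>)) \<longlonglongrightarrow> \<beta> / \<beta> * 1 powr (1 + \<beta>)"
    using assms
    by (intro tendsto_mult tendsto_divide pdiff_asymp LIMSEQ_Suc[OF pdiff_asymp] tendsto_powr tendsto_const)
       (real_asymp | simp)+
  moreover have "((1 + real (Suc k)) powr (1 + \<beta>) * pdiff \<beta> (Suc k)) / ((1 + real k) powr (1 + \<beta>) * pdiff \<beta> k)
     * ((1 + real k) / (2 + real k)) powr (1 + \<beta>) = pdiff \<beta> (Suc k) / pdiff \<beta> k" for k
    by (simp add: powr_divide)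
  ultimately show ?thesis
    using assms by simp
qed

lemma pdiff_tail:
  assumes "\<beta> > 0"
  shows "(\<lambda>j. pdiff \<beta> (j + n)) sums (1 + real n) powr (- \<beta>)"
proof -
  have lim: "(\<lambda>j. (1 + real (j + n)) powr (- \<beta>)) \<longlonglongrightarrow> 0"
    using assms by real_asymp
  have "(\<lambda>j. (1 + real (j + n)) powr (- \<beta>) - (1 + real (Suc j + n)) powr (- \<beta>)) sums ((1 + real (0 + n)) powr (- \<beta>) - 0)"
    by (rule telescope_sums'[OF lim])
  thus ?thesis
    by (simp add: pdiff_def add_ac)
qed

lemma pdiff_summable: "\<beta> > 0 \<Longrightarrow> summable (\<lambda>j. pdiff \<beta> (j + n))"
  using pdiff_tail by (rule sums_summable)

lemma pdiff_mult_summable: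
  assumes \<beta>: "\<beta> > 0" and e: "Bseq e"
  shows "summable (\<lambda>j. pdiff \<beta> (j + n) * e (j + n))"
proof -
  obtain K where K: "\<And>k. \<bar>e k\<bar> \<le> K"
    using e unfolding Bseq_def by auto
  have "summable (\<lambda>j. pdiff \<beta> (j + n) * K)"
    by (intro summable_mult2 pdiff_summable \<beta>)
  thus ?thesis
    by (rule summable_comparison_test')
       (use pdiff_pos[OF \<beta>] K in \<open>auto simp: abs_mult less_imp_le intro!: mult_left_mono\<close>)
qed

text \<open>The weights from n on have total mass exactly (1 + n)^(-\<beta>), so the normalized sum
  is a weighted mean of e over indices at least n.\<close>

lemma pdiff_tail_null:
  assumes \<beta>: "\<beta> > 0" and e: "e \<longlonglongrightarrow> 0"
  shows "(\<lambda>n. (1 + real n) powr \<beta> * (\<Sum>j. pdiff \<beta> (j + n) * e (j + n))) \<longlonglongrightarrow> 0"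
proof (rule LIMSEQ_I)
  fix r :: real assume r: "r > 0"
  have B: "Bseq e"
    using e by (intro convergent_imp_Bseq) (auto simp: convergent_def)
  obtain N where N: "\<And>k. k \<ge> N \<Longrightarrow> \<bar>e k\<bar> < r / 2"
    using LIMSEQ_D[OF e, of "r/2"] r by auto
  have "norm ((1 + real n) powr \<beta> * (\<Sum>j. pdiff \<beta> (j + n) * e (j + n)) - 0) < r" if n: "n \<ge> N" for n
  proof -
    have bd: "norm (pdiff \<beta> (j + n) * e (j + n)) \<le> pdiff \<beta> (j + n) * (r / 2)" for j
      using N[of "j + n"] n pdiff_pos[OF \<beta>, of "j + n"] by (auto simp: abs_mult intro!: mult_left_mono)
    have "norm (\<Sum>j. pdiff \<beta> (j + n) * e (j + n)) \<le> (\<Sum>j. pdiff \<beta> (j + n) * (r / 2))"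
      by (rule norm_suminf_le[OF bd]) (intro summable_mult2 pdiff_summable \<beta>)
    also have "\<dots> = (1 + real n) powr (- \<beta>) * (r / 2)"
      using sums_unique[OF sums_mult2[OF pdiff_tail[OF \<beta>, of n], of "r/2"]] by simp
    finally have "(1 + real n) powr \<beta> * norm (\<Sum>j. pdiff \<beta> (j + n) * e (j + n)) \<le> (1 + real n) powr \<beta> * ((1 + real n) powr (- \<beta>) * (r / 2))"
      by (rule mult_left_mono) simp
    also have "\<dots> = r / 2"
      by (simp add: powr_minus field_simps)
    finally show ?thesis
      using r by (simp add: abs_mult)
  qed
  thus "\<exists>no. \<forall>n\<ge>no. norm ((1 + real n) powr \<beta> * (\<Sum>j. pdiff \<beta> (j + n) * e (j + n)) - 0) < r"
    by blast
qed

lemma pdiff_cos_tail_const: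
  assumes "\<beta> > 0" "\<And>k::nat. cos (real k * \<phi>) = 1"
  shows "(\<lambda>n. (1 + real n) powr \<beta> * (\<Sum>j. pdiff \<beta> (j + n) * cos (real (j + n) * \<phi>))) \<longlonglongrightarrow> 1"
proof -
  have "(1 + real n) powr \<beta> * (\<Sum>j. pdiff \<beta> (j + n) * cos (real (j + n) * \<phi>)) = 1" for n
    using sums_unique[OF pdiff_tail[OF assms(1), of n], symmetric]
    by (simp only: assms(2) mult_1_right) (simp add: powr_minus)
  thus ?thesis by simp
qed

text \<open>Summation by parts with \<open>2 sin (\<phi>/2) cos (k \<phi>) = sin ((k + 1/2) \<phi>) - sin ((k - 1/2) \<phi>)\<close>;
  successive weights differ by a factor tending to 1.\<close>
lemma pdiff_cos_tail_null:
  assumes \<beta>: "\<beta> > 0" and \<phi>: "sin (\<phi> / 2) \<noteq> 0"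
  shows "(\<lambda>n. (1 + real n) powr \<beta> * (\<Sum>j. pdiff \<beta> (j + n) * cos (real (j + n) * \<phi>))) \<longlonglongrightarrow> 0"
proof -
  define y where "y = pdiff \<beta>"
  define s where "s = (\<lambda>k::nat. sin ((real k - 1 / 2) * \<phi>))"
  \<comment> \<open>Chosen so that y(k) e(k) = (y(k) - y(k+1)) s(k+1), the remainder of the
    summation by parts, takes the form covered by \<open>pdiff_tail_null\<close>.\<close>
  define e where "e = (\<lambda>k. (1 - y (Suc k) / y k) * s (Suc k))"
  have y: "y k > 0" for k
    unfolding y_def by (rule pdiff_pos[OF \<beta>])
  have Bs: "\<bar>s k\<bar> \<le> 1" for k
    by (simp add: s_def)
  have e: "e \<longlonglongrightarrow> 0"
  proof (rule tendsto_0_le)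
    show "(\<lambda>k. 1 - y (Suc k) / y k) \<longlonglongrightarrow> 0"
      using tendsto_diff[OF tendsto_const[of 1] pdiff_ratio[OF \<beta>]] by (simp add: y_def)
    show "\<forall>\<^sub>F k in sequentially. norm (e k) \<le> norm (1 - y (Suc k) / y k) * 1"
      using Bs by (auto simp: e_def abs_mult intro!: always_eventually mult_left_le)
  qed
  have Be: "Bseq e"
    using e by (intro convergent_imp_Bseq) (auto simp: convergent_def)
  have y0: "y \<longlonglongrightarrow> 0"
    using summable_LIMSEQ_zero[OF pdiff_summable[OF \<beta>, of 0]] by (simp add: y_def)
  have ys0: "(\<lambda>k. y k * s k) \<longlonglongrightarrow> 0"
    by (rule tendsto_0_le[OF y0, of _ 1]) (use Bs in \<open>auto simp: abs_mult intro!: always_eventually mult_left_le\<close>)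
  have step: "2 * sin (\<phi> / 2) * (y k * cos (real k * \<phi>)) = (y (Suc k) * s (Suc k) - y k * s k) + y k * e k" for k
  proof -
    have "s (Suc k) - s k = 2 * sin (\<phi> / 2) * cos (real k * \<phi>)"
      using sin_diff_sin[of "(real (Suc k) - 1/2) * \<phi>" "(real k - 1/2) * \<phi>"]
      by (simp add: s_def field_simps)
    moreover have "y k * e k = (y k - y (Suc k)) * s (Suc k)"
      using y[of k] by (simp add: e_def field_simps)
    ultimately show ?thesis
      by (simp add: algebra_simps)
  qed
  have main: "2 * sin (\<phi> / 2) * (\<Sum>j. y (j + n) * cos (real (j + n) * \<phi>)) = (\<Sum>j. y (j + n) * e (j + n)) - y n * s n" for n
  proof -
    have "(\<lambda>j. y (j + n) * s (j + n)) \<longlonglongrightarrow> 0"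
      by (rule LIMSEQ_ignore_initial_segment[OF ys0])
    from telescope_sums[OF this]
    have "(\<lambda>j. y (Suc (j + n)) * s (Suc (j + n)) - y (j + n) * s (j + n)) sums (0 - y n * s n)"
      by simp
    moreover have "(\<lambda>j. y (j + n) * e (j + n)) sums (\<Sum>j. y (j + n) * e (j + n))"
      unfolding y_def by (intro summable_sums pdiff_mult_summable \<beta> Be)
    ultimately have "(\<lambda>j. (y (Suc (j + n)) * s (Suc (j + n)) - y (j + n) * s (j + n)) + y (j + n) * e (j + n))
      sums (0 - y n * s n + (\<Sum>j. y (j + n) * e (j + n)))"
      by (rule sums_add)
    hence "(\<lambda>j. 2 * sin (\<phi> / 2) * (y (j + n) * cos (real (j + n) * \<phi>))) sums (0 - y n * s n + (\<Sum>j. y (j + n) * e (j + n)))"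
      by (simp only: step)
    moreover have "summable (\<lambda>j. y (j + n) * cos (real (j + n) * \<phi>))"
      unfolding y_def by (rule pdiff_mult_summable[OF \<beta>, of "\<lambda>k. cos (real k * \<phi>)"]) (auto intro!: BseqI'[of _ 1])
    ultimately show ?thesis
      by (simp add: sums_iff suminf_mult)
  qed
  have "(\<lambda>n. (1 + real n) powr \<beta> * y n) \<longlonglongrightarrow> 0"
  proof -
    have "(\<lambda>n. ((1 + real n) powr (1 + \<beta>) * y n) * (1 / (1 + real n))) \<longlonglongrightarrow> \<beta> * 0"
      unfolding y_def by (intro tendsto_mult pdiff_asymp \<beta>) real_asymp
    thus ?thesis
      by (simp add: powr_add)
  qed
  hence "(\<lambda>n. (1 + real n) powr \<beta> * y n * s n) \<longlonglongrightarrow> 0"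
    by (rule tendsto_0_le[of _ _ _ 1]) (use Bs in \<open>auto simp: abs_mult intro!: always_eventually mult_left_le\<close>)
  from tendsto_diff[OF pdiff_tail_null[OF \<beta> e] this]
  have "(\<lambda>n. (1 + real n) powr \<beta> * ((\<Sum>j. y (j + n) * e (j + n)) - y n * s n)) \<longlonglongrightarrow> 0"
    by (simp add: y_def algebra_simps)
  hence "(\<lambda>n. (1 + real n) powr \<beta> * (2 * sin (\<phi> / 2) * (\<Sum>j. y (j + n) * cos (real (j + n) * \<phi>))) / (2 * sin (\<phi> / 2))) \<longlonglongrightarrow> 0 / (2 * sin (\<phi> / 2))"
    unfolding main using \<phi> by (intro tendsto_divide tendsto_const) auto
  thus ?thesis
    using \<phi> by (simp add: y_def)
qed

text \<open>Replaces the power weight by the telescoping one. Their quotient tends to \<beta>, which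
  is why c turns into c / \<beta>.\<close>

lemma coeff_over_pdiff:
  assumes \<beta>: "\<beta> > 0"
    and A: "(\<lambda>k. (1 + real k) powr (1 + \<beta>) * A k - c * cos (real k * t0)) \<longlonglongrightarrow> 0"
  shows "(\<lambda>k. A k / pdiff \<beta> k - c / \<beta> * cos (real k * t0)) \<longlonglongrightarrow> 0"
proof -
  define W where "W = (\<lambda>k. (1 + real k) powr (1 + \<beta>) * pdiff \<beta> k)"
  define d where "d = (\<lambda>k. (1 + real k) powr (1 + \<beta>) * A k - c * cos (real k * t0))"
  have W: "W \<longlonglongrightarrow> \<beta>"
    unfolding W_def by (rule pdiff_asymp[OF \<beta>])
  have Wp: "W k > 0" for k
    unfolding W_def by (intro mult_pos_pos pdiff_pos \<beta>) simp
  have "(\<lambda>k. c * (1 / W k - 1 / \<beta>)) \<longlonglongrightarrow> c * (1 / \<beta> - 1 / \<beta>)"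
    using \<beta> by (intro tendsto_intros W) auto
  hence 1: "(\<lambda>k. c * (1 / W k - 1 / \<beta>)) \<longlonglongrightarrow> 0"
    by simp
  have 2: "(\<lambda>k. c * (1 / W k - 1 / \<beta>) * cos (real k * t0)) \<longlonglongrightarrow> 0"
    by (rule tendsto_0_le[OF 1, of _ 1]) (auto simp: abs_mult intro!: always_eventually mult_left_le mult_nonneg_nonneg)
  have "(\<lambda>k. d k / W k) \<longlonglongrightarrow> 0 / \<beta>"
    unfolding d_def using \<beta> by (intro tendsto_divide A W) auto
  from tendsto_add[OF this 2]
  have "(\<lambda>k. d k / W k + c * (1 / W k - 1 / \<beta>) * cos (real k * t0)) \<longlonglongrightarrow> 0"
    by simp
  moreover have "d k / W k + c * (1 / W k - 1 / \<beta>) * cos (real k * t0) = A k / pdiff \<beta> k - c / \<beta> * cos (real k * t0)" for k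
  proof -
    have "A k / pdiff \<beta> k = ((1 + real k) powr (1 + \<beta>) * A k) / W k"
      by (simp add: W_def)
    thus ?thesis
      by (simp add: d_def diff_divide_distrib right_diff_distrib left_diff_distrib)
  qed
  ultimately show ?thesis by simp
qed

text \<open>The product of cosines has frequencies t - t0 and t + t0, and each contributes only if
  it is a multiple of 2 pi. On [0, pi] the first happens only for t = t0, the second only for t = t0
  in {0, pi}; hence the doubled value at the endpoints.\<close>

lemma cosine_tail_limit:
  assumes \<beta>: "\<beta> > 0" and t0: "0 \<le> t0" "t0 \<le> pi" and t: "0 \<le> t" "t \<le> pi"
    and A: "(\<lambda>k. (1 + real k) powr (1 + \<beta>) * A k - c * cos (real k * t0)) \<longlonglongrightarrow> 0"
  shows "(\<lambda>n. (1 + real n) powr \<beta> * (\<Sum>j. A (j + n) * cos (real (j + n) * t))) \<longlonglongrightarrow>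
    (if t \<noteq> t0 then 0 else if sin t0 = 0 then c / \<beta> else c / (2 * \<beta>))"
proof -
  define e where "e = (\<lambda>k. A k / pdiff \<beta> k - c / \<beta> * cos (real k * t0))"
  have e: "e \<longlonglongrightarrow> 0"
    unfolding e_def by (rule coeff_over_pdiff[OF \<beta> A])
  define e' where "e' = (\<lambda>k. e k * cos (real k * t))"
  have e': "e' \<longlonglongrightarrow> 0"
    by (rule tendsto_0_le[OF e, of _ 1]) (auto simp: e'_def abs_mult intro!: always_eventually mult_left_le)
  have Be': "Bseq e'"
    using e' by (intro convergent_imp_Bseq) (auto simp: convergent_def)
  define Z where "Z = (\<lambda>\<phi> n. \<Sum>j. pdiff \<beta> (j + n) * cos (real (j + n) * \<phi>))"
  have sZ: "(\<lambda>j. pdiff \<beta> (j + n) * cos (real (j + n) * \<phi>)) sums Z \<phi> n" for \<phi> n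
    unfolding Z_def
    by (intro summable_sums pdiff_mult_summable[OF \<beta>, of "\<lambda>k. cos (real k * \<phi>)"]) (auto intro!: BseqI'[of _ 1])
  have split: "A k * cos (real k * t) = c / (2 * \<beta>) * (pdiff \<beta> k * cos (real k * (t - t0)) + pdiff \<beta> k * cos (real k * (t + t0))) + pdiff \<beta> k * e' k" for k
  proof -
    have "A k = pdiff \<beta> k * (c / \<beta> * cos (real k * t0) + e k)"
      using pdiff_pos[OF \<beta>, of k] by (simp add: e_def)
    hence "A k * cos (real k * t) = c / \<beta> * pdiff \<beta> k * (cos (real k * t) * cos (real k * t0)) + pdiff \<beta> k * e' k"
      unfolding e'_def by (simp only: distrib_left distrib_right mult_ac)
    moreover have "cos (real k * t) * cos (real k * t0) = (cos (real k * (t - t0)) + cos (real k * (t + t0))) / 2"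
      using cos_mult_cos[of "real k * t" "real k * t0"] by (simp add: algebra_simps)
    moreover have "c / \<beta> * p * ((X + Y) / 2) = c / (2 * \<beta>) * (p * X + p * Y)" for p X Y :: real
      by (simp add: distrib_left add_divide_distrib mult_ac)
    ultimately show ?thesis by simp
  qed
  have Asum: "(\<lambda>j. A (j + n) * cos (real (j + n) * t)) sums (c / (2 * \<beta>) * (Z (t - t0) n + Z (t + t0) n) + (\<Sum>j. pdiff \<beta> (j + n) * e' (j + n)))" for n
    unfolding split by (intro sums_add sums_mult sZ summable_sums pdiff_mult_summable \<beta> Be')
  have eq: "(1 + real n) powr \<beta> * (\<Sum>j. A (j + n) * cos (real (j + n) * t))
     = c / (2 * \<beta>) * ((1 + real n) powr \<beta> * Z (t - t0) n + (1 + real n) powr \<beta> * Z (t + t0) n)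
       + (1 + real n) powr \<beta> * (\<Sum>j. pdiff \<beta> (j + n) * e' (j + n))" for n
    unfolding sums_unique[OF Asum, symmetric] by (simp only: distrib_left mult_ac)
  have lim: "(\<lambda>n. (1 + real n) powr \<beta> * (\<Sum>j. A (j + n) * cos (real (j + n) * t))) \<longlonglongrightarrow> c / (2 * \<beta>) * (z1 + z2) + 0"
    if "(\<lambda>n. (1 + real n) powr \<beta> * Z (t - t0) n) \<longlonglongrightarrow> z1" "(\<lambda>n. (1 + real n) powr \<beta> * Z (t + t0) n) \<longlonglongrightarrow> z2" for z1 z2
    unfolding eq by (intro tendsto_add tendsto_mult tendsto_const that pdiff_tail_null[OF \<beta> e'])
  have Z0: "(\<lambda>n. (1 + real n) powr \<beta> * Z \<phi> n) \<longlonglongrightarrow> 0" if "sin (\<phi> / 2) \<noteq> 0" for \<phi>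
    unfolding Z_def by (rule pdiff_cos_tail_null[OF \<beta> that])
  have Z1: "(\<lambda>n. (1 + real n) powr \<beta> * Z \<phi> n) \<longlonglongrightarrow> 1" if "\<And>k::nat. cos (real k * \<phi>) = 1" for \<phi>
    unfolding Z_def by (rule pdiff_cos_tail_const[OF \<beta> that])
  show ?thesis
  proof (cases "t = t0")
    case True
    show ?thesis
    proof (cases "sin t0 = 0")
      case s: True
      have "t0 = 0 \<or> t0 = pi"
        using s t0 sin_gt_zero[of t0] by force
      hence "cos (real k * (t + t0)) = 1" for k
        using True cos_2npi[of k] by (auto simp: mult_ac mult_2[symmetric])
      from lim[OF Z1 Z1[OF this]] show ?thesis
        using True s by simp
    next
      case False
      from lim[OF Z1 Z0] show ?thesis
        using True False by simp
    qed
  next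
    case False
    have "sin ((t - t0) / 2) \<noteq> 0"
      using False t t0 sin_gt_zero[of "(t - t0) / 2"] sin_gt_zero[of "(t0 - t) / 2"] sin_minus[of "(t - t0) / 2"]
      by (cases "t > t0") (auto simp: minus_divide_left)
    moreover have "sin ((t + t0) / 2) > 0"
      using False t t0 by (intro sin_gt_zero) auto
    ultimately show ?thesis
      using lim[OF Z0 Z0] False by simp
  qed
qed

lemma cheb_proj_error_eq:
  assumes f: "continuous_on Omega f" and sm: "summable (\<lambda>k. \<bar>cheb_coeff f k\<bar>)" and x: "x \<in> Omega"
  shows "(\<lambda>j. cheb_coeff f (j + Suc n) * cheb_T (j + Suc n) x) sums (f x - cheb_proj f n x)"
proof -
  have "(\<lambda>m. cheb_proj f (m + n) x - cheb_proj f n x) \<longlonglongrightarrow> f x - cheb_proj f n x"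
    by (intro tendsto_intros LIMSEQ_ignore_initial_segment cheb_proj_tendsto f sm x)
  moreover have "cheb_proj f (m + n) x - cheb_proj f n x = (\<Sum>j<m. cheb_coeff f (j + Suc n) * cheb_T (j + Suc n) x)" for m
    by (induction m) (simp_all add: cheb_proj_def)
  ultimately show ?thesis
    by (simp add: sums_def)
qed

subsection \<open>Size of the best approximation error\<close>

lemma abs_le_max_norm:
  assumes "continuous_on Omega h" "x \<in> Omega"
  shows "\<bar>h x\<bar> \<le> max_norm h"
  unfolding max_norm_def
proof (rule cSUP_upper[OF assms(2)])
  have "compact ((\<lambda>x. \<bar>h x\<bar>) ` Omega)"
    by (intro compact_continuous_image continuous_intros assms) simp
  thus "bdd_above ((\<lambda>x. \<bar>h x\<bar>) ` Omega)"
    by (intro bounded_imp_bdd_above compact_imp_bounded)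
qed

lemma max_norm_le:
  assumes "\<And>x. x \<in> Omega \<Longrightarrow> \<bar>h x\<bar> \<le> M"
  shows "max_norm h \<le> M"
  unfolding max_norm_def by (rule cSUP_least) (use assms in auto)

text \<open>The projection serves as competitor. Measuring its coefficients against
  \<open>pdiff\<close> makes the majorizing tail explicit and uniform in x.\<close>

lemma best_approx_upper:
  assumes f: "continuous_on Omega f" and \<beta>: "\<beta> > 0"
    and A: "(\<lambda>k. (1 + real k) powr (1 + \<beta>) * cheb_coeff f k - c * cos (real k * t0)) \<longlonglongrightarrow> 0"
    and sm: "summable (\<lambda>k. \<bar>cheb_coeff f k\<bar>)"
    and p: "\<And>n. is_best_approx f n (p n)"
  obtains K where "K > 0" "\<And>n. (2 + real n) powr \<beta> * max_norm (\<lambda>x. f x - poly (p n) x) \<le> K"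
proof -
  define e where "e = (\<lambda>k. cheb_coeff f k / pdiff \<beta> k)"
  have "Bseq (\<lambda>k. e k - c / \<beta> * cos (real k * t0))"
    using coeff_over_pdiff[OF \<beta> A] by (intro convergent_imp_Bseq) (auto simp: convergent_def e_def)
  then obtain K1 where K1: "\<And>k. \<bar>e k - c / \<beta> * cos (real k * t0)\<bar> \<le> K1"
    unfolding Bseq_def by auto
  define K where "K = \<bar>K1\<bar> + \<bar>c / \<beta>\<bar> + 1"
  have K: "\<bar>cheb_coeff f k\<bar> \<le> pdiff \<beta> k * K" for k
  proof -
    have "\<bar>c / \<beta> * cos (real k * t0)\<bar> \<le> \<bar>c / \<beta>\<bar>"
      unfolding abs_mult by (intro mult_left_le) auto
    hence "\<bar>e k\<bar> \<le> K"
      using K1[of k] unfolding K_def by linarith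
    thus ?thesis
      using pdiff_pos[OF \<beta>, of k] by (simp add: e_def field_simps)
  qed
  have "(2 + real n) powr \<beta> * max_norm (\<lambda>x. f x - poly (p n) x) \<le> K" for n
  proof -
    obtain q where q: "degree q \<le> n" "\<And>x. x \<in> Omega \<Longrightarrow> cheb_proj f n x = poly q x"
      using cheb_proj_is_poly[of n f] by blast
    have "max_norm (\<lambda>x. f x - poly (p n) x) \<le> max_norm (\<lambda>x. f x - poly q x)"
      using p[of n] q(1) by (simp add: is_best_approx_def)
    also have "\<dots> \<le> (2 + real n) powr (- \<beta>) * K"
    proof (rule max_norm_le)
      fix x :: real assume x: "x \<in> Omega"
      \<comment> \<open>The error starts at degree n + 1, which is why the bound is a power of 2 +
        n.\<close>
      have S: "(\<lambda>j. pdiff \<beta> (j + Suc n) * K) sums ((2 + real n) powr (- \<beta>) * K)"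
        using sums_mult2[OF pdiff_tail[OF \<beta>, of "Suc n"], of K] by (simp add: add_ac)
      have bd: "norm (cheb_coeff f (j + Suc n) * cheb_T (j + Suc n) x) \<le> pdiff \<beta> (j + Suc n) * K" for j
      proof -
        have "\<bar>cheb_coeff f (j + Suc n) * cheb_T (j + Suc n) x\<bar> \<le> \<bar>cheb_coeff f (j + Suc n)\<bar>"
          unfolding abs_mult by (intro mult_left_le) (auto simp: cheb_T_def)
        with K[of "j + Suc n"] show ?thesis by simp
      qed
      have "norm (\<Sum>j. cheb_coeff f (j + Suc n) * cheb_T (j + Suc n) x) \<le> (\<Sum>j. pdiff \<beta> (j + Suc n) * K)"
        by (rule norm_suminf_le[OF bd sums_summable[OF S]])
      thus "\<bar>f x - poly q x\<bar> \<le> (2 + real n) powr (- \<beta>) * K"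
        using sums_unique[OF cheb_proj_error_eq[OF f sm x, of n]] sums_unique[OF S] q(2)[OF x] by simp
    qed
    finally have "(2 + real n) powr \<beta> * max_norm (\<lambda>x. f x - poly (p n) x) \<le> (2 + real n) powr \<beta> * ((2 + real n) powr (- \<beta>) * K)"
      by (rule mult_left_mono) simp
    also have "\<dots> = K"
      by (simp add: powr_minus)
    finally show ?thesis .
  qed
  moreover have "K > 0"
    by (simp add: K_def add_nonneg_pos)
  ultimately show ?thesis
    using that by blast
qed

text \<open>Averaging the error of the projection at \<open>\<xi>\<close> over degrees \<open>n, \<dots>, 2 n - 1\<close> costs only a
  factor 4 against the best approximation, and by the limit all these errors have the same sign.\<close>
lemma best_approx_lower:
  assumes f: "continuous_on Omega f" and \<beta>: "\<beta> > 0" and \<xi>: "\<xi> \<in> Omega" and L: "L \<noteq> 0"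
    and lim: "(\<lambda>n. (2 + real n) powr \<beta> * (f \<xi> - cheb_proj f n \<xi>)) \<longlonglongrightarrow> L"
    and p: "\<And>n. is_best_approx f n (p n)"
  obtains \<delta> where "\<delta> > 0"
    "\<forall>\<^sub>F n in sequentially. (2 + real n) powr \<beta> * max_norm (\<lambda>x. f x - poly (p n) x) \<ge> \<delta>"
proof -
  \<comment> \<open>The sign of L is factored out so that the errors are eventually positive and
    cannot cancel in the average.\<close>
  define r where "r = (\<lambda>n. sgn L * (f \<xi> - cheb_proj f n \<xi>))"
  have "(\<lambda>n. sgn L * ((2 + real n) powr \<beta> * (f \<xi> - cheb_proj f n \<xi>))) \<longlonglongrightarrow> sgn L * L"
    by (intro tendsto_mult tendsto_const lim)
  hence "(\<lambda>n. (2 + real n) powr \<beta> * r n) \<longlonglongrightarrow> \<bar>L\<bar>"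
    by (simp add: r_def mult_ac abs_sgn)
  hence "\<forall>\<^sub>F n in sequentially. (2 + real n) powr \<beta> * r n > \<bar>L\<bar> / 2"
    using L by (intro order_tendstoD) auto
  then obtain N where N: "\<And>n. n \<ge> N \<Longrightarrow> (2 + real n) powr \<beta> * r n > \<bar>L\<bar> / 2"
    by (auto simp: eventually_sequentially)
  \<comment> \<open>Half of |L| is kept from the limit, the window bound costs 4, and 2 + m <= 2 (2
    + n) for degrees m below 2n costs \<open>2 powr (- \<beta>)\<close>.\<close>
  define \<delta> where "\<delta> = \<bar>L\<bar> / 8 * 2 powr (- \<beta>)"
  have "(2 + real n) powr \<beta> * max_norm (\<lambda>x. f x - poly (p n) x) \<ge> \<delta>" if n: "n \<ge> Suc N" for n
  proof -
    define E where "E = max_norm (\<lambda>x. f x - poly (p n) x)"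
    have "\<bar>f x - poly (p n) x\<bar> \<le> E" if "x \<in> Omega" for x
      unfolding E_def by (rule abs_le_max_norm) (intro continuous_intros f that)+
    hence E: "\<bar>\<Sum>m=n..<2*n. cheb_proj f m \<xi> - f \<xi>\<bar> \<le> 4 * real n * E"
      using p[of n] \<xi> by (intro sum_cheb_proj_error[OF f, of "p n"]) (auto simp: is_best_approx_def)
    have "\<bar>L\<bar> / 2 * (2 * (2 + real n)) powr (- \<beta>) \<le> r m" if m: "m \<in> {n..<2*n}" for m
    proof -
      have "(2 * (2 + real n)) powr (- \<beta>) \<le> (2 + real m) powr (- \<beta>)"
        using m \<beta> by (intro powr_mono2') auto
      hence "\<bar>L\<bar> / 2 * (2 * (2 + real n)) powr (- \<beta>) \<le> \<bar>L\<bar> / 2 * (2 + real m) powr (- \<beta>)"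
        by (rule mult_left_mono) simp
      also have "\<dots> \<le> r m"
        using N[of m] m n by (simp add: powr_minus field_simps)
      finally show ?thesis .
    qed
    hence "(\<Sum>m=n..<2*n. \<bar>L\<bar> / 2 * (2 * (2 + real n)) powr (- \<beta>)) \<le> (\<Sum>m=n..<2*n. r m)"
      by (rule sum_mono)
    also have "\<dots> = sgn L * - (\<Sum>m=n..<2*n. cheb_proj f m \<xi> - f \<xi>)"
      by (simp add: r_def sum_distrib_left sum_negf[symmetric])
    also have "\<dots> \<le> \<bar>\<Sum>m=n..<2*n. cheb_proj f m \<xi> - f \<xi>\<bar>"
      by (simp add: sgn_if abs_ge_self abs_ge_minus_self)
    also note E
    finally have "real n * (\<bar>L\<bar> / 2 * (2 * (2 + real n)) powr (- \<beta>)) \<le> real n * (4 * E)"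
      by (simp add: mult_ac)
    hence "\<bar>L\<bar> / 2 * (2 * (2 + real n)) powr (- \<beta>) \<le> 4 * E"
      using n by (subst (asm) mult_le_cancel_left_pos) auto
    hence "(2 + real n) powr \<beta> * (\<bar>L\<bar> / 8 * (2 powr (- \<beta>) * (2 + real n) powr (- \<beta>))) \<le> (2 + real n) powr \<beta> * E"
      unfolding powr_mult by (intro mult_left_mono) auto
    moreover have "(2 + real n) powr \<beta> * (\<bar>L\<bar> / 8 * (2 powr (- \<beta>) * (2 + real n) powr (- \<beta>))) = \<delta>"
      by (simp add: \<delta>_def powr_minus)
    ultimately show ?thesis
      unfolding E_def by linarith
  qed
  moreover have "\<delta> > 0"
    using L by (simp add: \<delta>_def)
  ultimately show ?thesis
    using that by (auto simp: eventually_sequentially)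
qed

section \<open>Comparison of the projection error with the best approximation error\<close>

theorem mainTheorem2:
  fixes \<xi> \<alpha> :: real and g f :: "real \<Rightarrow> real" and p :: "nat \<Rightarrow> real poly"
  assumes "\<xi> \<in> Omega"
    and "admissible_exponent \<xi> \<alpha>"
    and "smooth_within g Omega"
    and "g \<xi> \<noteq> 0"
    and "f = model_function \<xi> \<alpha> g"
    and "\<And>n. is_best_approx f n (p n)"
  shows "V0 f p = Omega - {\<xi>}"
proof -
  note \<xi> = assms(1)
  obtain \<beta> c where \<beta>: "\<beta> > 0" and c: "c \<noteq> 0"
    and A: "(\<lambda>k. (1 + real k) powr (1 + \<beta>) * cheb_coeff f k - c * cos (real k * arccos \<xi>)) \<longlonglongrightarrow> 0"
    using model_function_coeff_asymp[OF assms(1-4)] unfolding assms(5) by blast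
  have f: "continuous_on Omega f"
    unfolding assms(5) using assms(2,3)
    by (intro continuous_on_model_function smooth_within_continuous_on) (auto simp: admissible_exponent_def)
  have "Bseq (\<lambda>k. (1 + real k) powr (1 + \<beta>) * cheb_coeff f k - c * cos (real k * arccos \<xi>))"
    using A by (intro convergent_imp_Bseq) (auto simp: convergent_def)
  then obtain K0 where K0: "\<And>k. \<bar>(1 + real k) powr (1 + \<beta>) * cheb_coeff f k - c * cos (real k * arccos \<xi>)\<bar> \<le> K0"
    unfolding Bseq_def by auto
  have "Bseq (\<lambda>k. (1 + real k) powr (1 + \<beta>) * cheb_coeff f k)"
  proof (rule BseqI')
    fix k
    have "\<bar>c * cos (real k * arccos \<xi>)\<bar> \<le> \<bar>c\<bar>"
      unfolding abs_mult by (intro mult_left_le) auto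
    with K0[of k] show "norm ((1 + real k) powr (1 + \<beta>) * cheb_coeff f k) \<le> K0 + \<bar>c\<bar>"
      unfolding real_norm_def by linarith
  qed
  hence sm: "summable (\<lambda>k. \<bar>cheb_coeff f k\<bar>)"
    using \<beta> by (intro summable_weighted[of "1 + \<beta>"]) auto
  define E where "E = (\<lambda>n. max_norm (\<lambda>x. f x - poly (p n) x))"
  define W where "W = (\<lambda>n. (2 + real n) powr \<beta>)"
  define L where "L = (\<lambda>x. if arccos x \<noteq> arccos \<xi> then 0 else if sin (arccos \<xi>) = 0 then c / \<beta> else c / (2 * \<beta>))"
  have lim: "(\<lambda>n. W n * (f x - cheb_proj f n x)) \<longlonglongrightarrow> L x" if x: "x \<in> Omega" for x
  proof -
    have "(\<lambda>n. (1 + real n) powr \<beta> * (\<Sum>j. cheb_coeff f (j + n) * cos (real (j + n) * arccos x))) \<longlonglongrightarrow> L x"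
      unfolding L_def using \<xi> x by (intro cosine_tail_limit[OF \<beta> _ _ _ _ A]) (auto simp: arccos_lbound arccos_ubound)
    from LIMSEQ_Suc[OF this]
    have "(\<lambda>n. (1 + real (Suc n)) powr \<beta> * (\<Sum>j. cheb_coeff f (j + Suc n) * cheb_T (j + Suc n) x)) \<longlonglongrightarrow> L x"
      by (simp only: cheb_T_def)
    thus ?thesis
      using sums_unique[OF cheb_proj_error_eq[OF f sm x]] by (simp add: W_def)
  qed
  have L\<xi>: "L \<xi> \<noteq> 0"
    using c \<beta> by (simp add: L_def)
  have L0: "L x = 0" if "x \<in> Omega - {\<xi>}" for x
    using that \<xi> arccos_eq_iff[of x \<xi>] by (auto simp: L_def abs_le_iff)
  obtain K where K: "K > 0" "\<And>n. W n * E n \<le> K"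
    using best_approx_upper[OF f \<beta> A sm assms(6)] unfolding W_def E_def by blast
  obtain \<delta> where \<delta>: "\<delta> > 0" "\<forall>\<^sub>F n in sequentially. W n * E n \<ge> \<delta>"
    using best_approx_lower[OF f \<beta> \<xi> L\<xi> lim[OF \<xi>, unfolded W_def] assms(6)] unfolding W_def E_def by blast
  have Wpos: "W n > 0" for n
    by (simp add: W_def)
  \<comment> \<open>After scaling by W the numerator tends to |L x| and the denominator eventually
    lies between \<delta> and K. The lower bound gives convergence to 0 away from \<xi>, the upper
    bound prevents it at \<xi>.\<close>
  have ratio: "\<bar>f x - cheb_proj f n x\<bar> / E n = \<bar>W n * (f x - cheb_proj f n x)\<bar> / (W n * E n)" for x n
    using Wpos[of n] by (simp add: abs_mult)
  have "x \<in> V0 f p" if x: "x \<in> Omega - {\<xi>}" for x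
  proof -
    have "(\<lambda>n. W n * (f x - cheb_proj f n x)) \<longlonglongrightarrow> 0"
      using lim[of x] L0[OF x] x by simp
    moreover have "\<forall>\<^sub>F n in sequentially. norm (\<bar>f x - cheb_proj f n x\<bar> / E n) \<le> norm (W n * (f x - cheb_proj f n x)) * (1 / \<delta>)"
      using \<delta>(2)
    proof eventually_elim
      case (elim n)
      show ?case
      proof -
        have WE: "W n * E n > 0"
          using elim \<delta>(1) by linarith
        have "norm (\<bar>f x - cheb_proj f n x\<bar> / E n) = \<bar>W n * (f x - cheb_proj f n x)\<bar> / (W n * E n)"
          unfolding ratio using WE by (simp add: abs_of_pos)
        also have "\<dots> \<le> \<bar>W n * (f x - cheb_proj f n x)\<bar> / \<delta>"
          using elim \<delta>(1) WE by (intro divide_left_mono mult_pos_pos[OF WE \<delta>(1)]) auto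
        finally show ?thesis by simp
      qed
    qed
    ultimately have "(\<lambda>n. \<bar>f x - cheb_proj f n x\<bar> / E n) \<longlonglongrightarrow> 0"
      by (rule tendsto_0_le)
    thus ?thesis
      using x by (simp add: V0_def E_def)
  qed
  moreover have "\<xi> \<notin> V0 f p"
  proof
    assume "\<xi> \<in> V0 f p"
    hence R: "(\<lambda>n. \<bar>f \<xi> - cheb_proj f n \<xi>\<bar> / E n) \<longlonglongrightarrow> 0"
      by (simp add: V0_def E_def)
    have "(\<lambda>n. W n * (f \<xi> - cheb_proj f n \<xi>)) \<longlonglongrightarrow> 0"
    proof (rule tendsto_0_le[OF R])
      show "\<forall>\<^sub>F n in sequentially. norm (W n * (f \<xi> - cheb_proj f n \<xi>)) \<le> norm (\<bar>f \<xi> - cheb_proj f n \<xi>\<bar> / E n) * K"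
        using \<delta>(2)
      proof eventually_elim
        case (elim n)
        \<comment> \<open>Positivity matters here: with y / 0 = 0, a vanishing \<open>E n\<close>
          would make the quotient 0 and carry no information about the numerator.\<close>
        have WE: "W n * E n > 0"
          using elim \<delta>(1) by linarith
        have "\<bar>W n * (f \<xi> - cheb_proj f n \<xi>)\<bar> = \<bar>W n * (f \<xi> - cheb_proj f n \<xi>)\<bar> / (W n * E n) * (W n * E n)"
          using less_imp_neq[OF WE] by (metis nonzero_eq_divide_eq)
        also have "\<dots> \<le> \<bar>W n * (f \<xi> - cheb_proj f n \<xi>)\<bar> / (W n * E n) * K"
          using WE by (intro mult_left_mono K) auto
        also have "\<dots> \<le> norm (\<bar>f \<xi> - cheb_proj f n \<xi>\<bar> / E n) * K"
          unfolding ratio using K(1) WE by (simp add: abs_of_pos)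
        finally show ?case by simp
      qed
    qed
    with lim[OF \<xi>] L\<xi> show False
      using LIMSEQ_unique by blast
  qed
  moreover have "V0 f p \<subseteq> Omega"
    by (auto simp: V0_def)
  ultimately show ?thesis by blast
qed

end
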